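(* Let $K$ be an algebraically closed field and let $d \geq 2$ be a fixed integer. Then the generic border subrank of tensors in $(K^n)^{\otimes d}$ is $O(n^{1/(d-1)})$ for $n \to \infty$.
   Context: For a nonnegative integer $r$, let $e_1,\ldots,e_r$ be the standard basis of $K^r$; the $r$-th unit tensor is $I_r := \sum_{i=1}^r e_i^{\otimes d} \in (K^r)^{\otimes d}$. The border subrank of a tensor $T \in V_1 \otimes \cdots \otimes V_d$ (with $V_1,\ldots,V_d$ finite-dimensional $K$-vector spaces) is the maximal $r$ for which $I_r$ lies in the Zariski closure (in $(K^r)^{\otimes d}$) of the set $\{(\phi_1 \otimes \cdots \otimes \phi_d)T \mid \phi_i \in \mathrm{Hom}(V_i,K^r),\ i=1,\ldots,d\}$. For each $r$, the set $X_r \subseteq V_1\otimes\cdots\otimes V_d$ of tensors of border subrank precisely $r$ is constructible, and hence there is a unique $r$ for which $X_r$ is Zariski dense in $V_1 \otimes \cdots \otimes V_d$ (and this $X_r$ then contains a Zariski open dense subset); this $r$ is called the generic border subrank of tensors in $V_1 \otimes \cdots \otimes V_d$. *)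

theory Defs
  imports
    "HOL-Computational_Algebra.Polynomial"
    "HOL-Library.Landau_Symbols"
    "Jordan_Normal_Form.Determinant"
begin

section \<open>The Zariski topology on a coordinate space\<close>

text \<open>
  For an index set \<open>I\<close>, the space \<open>K\<^sup>I\<close> is rendered as the set of functions that vanish outside
  \<open>I\<close>. All index sets used below are finite.
\<close>

definition coord_space :: "'i set \<Rightarrow> ('i \<Rightarrow> 'a::field) set" where
  "coord_space I = {x. \<forall>i. i \<notin> I \<longrightarrow> x i = 0}"

text \<open>
  Only the values of polynomials matter for zero loci, so we work with the algebra of polynomial
  functions in the coordinates instead of formal multivariate polynomials.
\<close>

inductive_set poly_fun :: "'i set \<Rightarrow> (('i \<Rightarrow> 'a::field) \<Rightarrow> 'a) set" for I :: "'i set" where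
  const: "(\<lambda>x. c) \<in> poly_fun I"
| coord: "i \<in> I \<Longrightarrow> (\<lambda>x. x i) \<in> poly_fun I"
| add: "f \<in> poly_fun I \<Longrightarrow> g \<in> poly_fun I \<Longrightarrow> (\<lambda>x. f x + g x) \<in> poly_fun I"
| mult: "f \<in> poly_fun I \<Longrightarrow> g \<in> poly_fun I \<Longrightarrow> (\<lambda>x. f x * g x) \<in> poly_fun I"

definition vanishing_ideal :: "'i set \<Rightarrow> ('i \<Rightarrow> 'a::field) set \<Rightarrow> (('i \<Rightarrow> 'a) \<Rightarrow> 'a) set" where
  "vanishing_ideal I S = {f \<in> poly_fun I. \<forall>x\<in>S. f x = 0}"

definition zero_locus :: "'i set \<Rightarrow> (('i \<Rightarrow> 'a::field) \<Rightarrow> 'a) set \<Rightarrow> ('i \<Rightarrow> 'a) set" where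
  "zero_locus I F = {x \<in> coord_space I. \<forall>f\<in>F. f x = 0}"

definition zariski_closure :: "'i set \<Rightarrow> ('i \<Rightarrow> 'a::field) set \<Rightarrow> ('i \<Rightarrow> 'a) set" where
  "zariski_closure I S = zero_locus I (vanishing_ideal I S)"

definition zariski_dense :: "'i set \<Rightarrow> ('i \<Rightarrow> 'a::field) set \<Rightarrow> bool" where
  "zariski_dense I S \<longleftrightarrow> S \<subseteq> coord_space I \<and> zariski_closure I S = coord_space I"


section \<open>Tensors and border subrank\<close>

text \<open>
  A tensor of shape \<open>ns = [n\<^sub>1, \<dots>, n\<^sub>d]\<close>, i.e. an element of the tensor product of
  \<open>K\<^bsup>n\<^sub>1\<^esup>, \<dots>, K\<^bsup>n\<^sub>d\<^esup>\<close>, is given by its coordinates with respect to the standard basis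
  \<open>e\<^bsub>j\<^sub>1\<^esub> \<otimes> \<dots> \<otimes> e\<^bsub>j\<^sub>d\<^esub>\<close>, indexed by the lists \<open>[j\<^sub>1, \<dots>, j\<^sub>d]\<close> with \<open>j\<^sub>k < n\<^sub>k\<close> (indices start at 0).
  The \<open>d\<close>-th tensor power of \<open>K\<^sup>n\<close> is the case \<open>ns = replicate d n\<close>.
\<close>

definition multi_indices :: "nat list \<Rightarrow> nat list set" where
  "multi_indices ns = {js. list_all2 (<) js ns}"

definition tensors :: "nat list \<Rightarrow> (nat list \<Rightarrow> 'a::field) set" where
  "tensors ns = coord_space (multi_indices ns)"

definition unit_tensor :: "nat \<Rightarrow> nat \<Rightarrow> nat list \<Rightarrow> 'a::field" where
  "unit_tensor d r = (\<lambda>is. \<Sum>i<r. if is = replicate d i then 1 else 0)"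

text \<open>
  The tensor \<open>(\<phi>\<^sub>1 \<otimes> \<dots> \<otimes> \<phi>\<^sub>d) T\<close> for linear maps \<open>\<phi>\<^sub>k : K\<^bsup>n\<^sub>k\<^esup> \<rightarrow> K\<^sup>r\<close>, the latter being given by
  their \<open>r \<times> n\<^sub>k\<close> matrices; the factors are numbered from 0.
\<close>

definition tensor_apply ::
    "nat list \<Rightarrow> nat \<Rightarrow> (nat \<Rightarrow> 'a::field mat) \<Rightarrow> (nat list \<Rightarrow> 'a) \<Rightarrow> nat list \<Rightarrow> 'a" where
  "tensor_apply ns r \<phi> T = (\<lambda>is.
     if is \<in> multi_indices (replicate (length ns) r)
     then \<Sum>js\<in>multi_indices ns. (\<Prod>k<length ns. \<phi> k $$ (is ! k, js ! k)) * T js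
     else 0)"

definition tensor_images :: "nat list \<Rightarrow> nat \<Rightarrow> (nat list \<Rightarrow> 'a::field) \<Rightarrow> (nat list \<Rightarrow> 'a) set" where
  "tensor_images ns r T =
     {tensor_apply ns r \<phi> T | \<phi>. \<forall>k<length ns. \<phi> k \<in> carrier_mat r (ns ! k)}"

text \<open>
  The maximum exists if there are at least two tensor factors, see \<open>border_subrank_le\<close> below.
\<close>

definition border_subrank :: "nat list \<Rightarrow> (nat list \<Rightarrow> 'a::field) \<Rightarrow> nat" where
  "border_subrank ns T = (GREATEST r.
     unit_tensor (length ns) r
       \<in> zariski_closure (multi_indices (replicate (length ns) r)) (tensor_images ns r T))"

text \<open>
  The generic border subrank is the unique \<open>r\<close> satisfying the following predicate. Existence over
  algebraically closed fields is shown below (\<open>ex_is_generic_border_subrank\<close>).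
\<close>

definition is_generic_border_subrank :: "'a::field itself \<Rightarrow> nat list \<Rightarrow> nat \<Rightarrow> bool" where
  "is_generic_border_subrank _ ns r \<longleftrightarrow>
     zariski_dense (multi_indices ns) {T :: nat list \<Rightarrow> 'a. T \<in> tensors ns \<and> border_subrank ns T = r}"


section \<open>The notions are well defined\<close>

lemma multi_indices_replicate:
  "multi_indices (replicate d r) = {js. length js = d \<and> (\<forall>k<d. js ! k < r)}"
  by (auto simp: multi_indices_def list_all2_conv_all_nth)

lemma finite_multi_indices: "finite (multi_indices ns)"
proof (rule finite_subset)
  show "multi_indices ns \<subseteq> {js. set js \<subseteq> {..<Suc (sum_list ns)} \<and> length js = length ns}"
  proof
    fix js assume "js \<in> multi_indices ns"
    hence l: "length js = length ns" and b: "\<And>k. k < length ns \<Longrightarrow> js ! k < ns ! k"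
      by (auto simp: multi_indices_def list_all2_conv_all_nth)
    have "js ! k < Suc (sum_list ns)" if "k < length ns" for k
      using b[OF that] elem_le_sum_list[of k ns] that by linarith
    thus "js \<in> {js. set js \<subseteq> {..<Suc (sum_list ns)} \<and> length js = length ns}"
      using l by (auto simp: in_set_conv_nth)
  qed
  show "finite {js. set js \<subseteq> {..<Suc (sum_list ns)} \<and> length js = length ns}"
    by (rule finite_lists_length_eq) auto
qed

lemma poly_fun_sum: "(\<And>a. a \<in> A \<Longrightarrow> f a \<in> poly_fun I) \<Longrightarrow> (\<lambda>x. \<Sum>a\<in>A. f a x) \<in> poly_fun I"
  by (induction A rule: infinite_finite_induct) (auto intro: poly_fun.intros)

lemma poly_fun_prod: "(\<And>a. a \<in> A \<Longrightarrow> f a \<in> poly_fun I) \<Longrightarrow> (\<lambda>x. \<Prod>a\<in>A. f a x) \<in> poly_fun I"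
  by (induction A rule: infinite_finite_induct) (auto intro: poly_fun.intros)

lemma unit_tensor_in_closure_imp_le:
  fixes T :: "nat list \<Rightarrow> 'a::field"
  assumes d: "length ns \<ge> 2"
    and cl: "unit_tensor (length ns) r
               \<in> zariski_closure (multi_indices (replicate (length ns) r)) (tensor_images ns r T)"
  shows "r \<le> ns ! 0"
proof (rule ccontr)
  assume "\<not> r \<le> ns ! 0"
  define d where "d = length ns"
  define m where "m = Suc (ns ! 0)"
  have mr: "m \<le> r" using \<open>\<not> r \<le> ns ! 0\<close> by (simp add: m_def)
  have d2: "d \<ge> 2" using d by (simp add: d_def)
  define ix where "ix = (\<lambda>a b::nat. a # replicate (d - 1) b)"
  have ix_in: "ix a b \<in> multi_indices (replicate d r)" if "a < m" "b < m" for a b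
    using that mr d2 by (auto simp: multi_indices_replicate ix_def nth_Cons')
  have ix_nth: "ix a b ! k = (if k = 0 then a else b)" if "k < d" for a b k
    using that by (auto simp: ix_def nth_Cons')
  define M where "M = (\<lambda>x :: nat list \<Rightarrow> 'a. mat m m (\<lambda>(a, b). x (ix a b)))"
  define f where "f = (\<lambda>x. det (M x))"
  have f_alt: "f x = (\<Sum>p | p permutes {0..<m}. signof p * (\<Prod>i = 0..<m. x (ix i (p i))))" for x
  proof -
    have "f x = (\<Sum>p | p permutes {0..<m}. signof p * (\<Prod>i = 0..<m. M x $$ (i, p i)))"
      unfolding f_def by (rule det_def') (simp add: M_def)
    also have "\<dots> = (\<Sum>p | p permutes {0..<m}. signof p * (\<Prod>i = 0..<m. x (ix i (p i))))"
    proof (intro sum.cong refl arg_cong2[of _ _ _ _ "(*)"] prod.cong)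
      fix p i assume "p \<in> {p. p permutes {0..<m}}" "i \<in> {0..<m}"
      moreover from this have "p i \<in> {0..<m}" using permutes_in_image[of p "{0..<m}" i] by simp
      ultimately show "M x $$ (i, p i) = x (ix i (p i))" by (auto simp: M_def)
    qed
    finally show ?thesis .
  qed
  have "f \<in> poly_fun (multi_indices (replicate d r))"
    unfolding f_alt[abs_def]
  proof (intro poly_fun_sum poly_fun.mult poly_fun.const poly_fun_prod poly_fun.coord)
    fix p i assume "p \<in> {p. p permutes {0..<m}}" "i \<in> {0..<m}"
    moreover from this have "p i \<in> {0..<m}" using permutes_in_image[of p "{0..<m}" i] by simp
    ultimately show "ix i (p i) \<in> multi_indices (replicate d r)" by (auto intro: ix_in)
  qed
  moreover have "f y = 0" if "y \<in> tensor_images ns r T" for y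
  proof -
    obtain \<phi> where y: "y = tensor_apply ns r \<phi> T" using \<open>y \<in> _\<close> by (auto simp: tensor_images_def)
    define B where
      "B = (\<lambda>j b. \<Sum>js | js \<in> multi_indices ns \<and> js ! 0 = j.
              (\<Prod>k\<in>{1..<d}. \<phi> k $$ (b, js ! k)) * T js)"
    define P where "P = mat m m (\<lambda>(a, j). if j < ns ! 0 then \<phi> 0 $$ (a, j) else 0)"
    define Q where "Q = mat m m (\<lambda>(j, b). B j b)"
    have y_ix: "y (ix a b) = (\<Sum>j<ns ! 0. \<phi> 0 $$ (a, j) * B j b)" if "a < m" "b < m" for a b
    proof -
      let ?g = "\<lambda>js. \<phi> 0 $$ (a, js ! 0) * ((\<Prod>k\<in>{1..<d}. \<phi> k $$ (b, js ! k)) * T js)"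
      have "y (ix a b) = (\<Sum>js\<in>multi_indices ns. (\<Prod>k<d. \<phi> k $$ (ix a b ! k, js ! k)) * T js)"
        using ix_in[OF that] by (simp add: y tensor_apply_def d_def)
      also have "\<dots> = (\<Sum>js\<in>multi_indices ns. ?g js)"
      proof (rule sum.cong[OF refl])
        fix js
        have "{..<d} = insert 0 {1..<d}" using d2 by auto
        hence "(\<Prod>k<d. \<phi> k $$ (ix a b ! k, js ! k)) =
            \<phi> 0 $$ (ix a b ! 0, js ! 0) * (\<Prod>k\<in>{1..<d}. \<phi> k $$ (ix a b ! k, js ! k))"
          by simp
        also have "(\<Prod>k\<in>{1..<d}. \<phi> k $$ (ix a b ! k, js ! k)) = (\<Prod>k\<in>{1..<d}. \<phi> k $$ (b, js ! k))"
          by (rule prod.cong) (auto simp: ix_nth)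
        finally show "(\<Prod>k<d. \<phi> k $$ (ix a b ! k, js ! k)) * T js = ?g js"
          using d2 by (simp add: ix_nth mult.assoc)
      qed
      also have "\<dots> = (\<Sum>j<ns ! 0. \<Sum>js | js \<in> multi_indices ns \<and> js ! 0 = j. ?g js)"
      proof (rule sum.group[symmetric])
        have "js ! 0 < ns ! 0" if "js \<in> multi_indices ns" for js
        proof (rule list_all2_nthD2)
          show "list_all2 (<) js ns" using that by (simp add: multi_indices_def)
          show "0 < length ns" using d by linarith
        qed
        thus "(\<lambda>js. js ! 0) ` multi_indices ns \<subseteq> {..<ns ! 0}" by (simp add: image_subset_iff)
      qed (simp_all add: finite_multi_indices)
      also have "\<dots> = (\<Sum>j<ns ! 0. \<phi> 0 $$ (a, j) * B j b)"
        unfolding B_def sum_distrib_left by (intro sum.cong refl) auto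
      finally show ?thesis .
    qed
    have "M y = P * Q"
    proof (rule eq_matI)
      fix a b assume "a < dim_row (P * Q)" "b < dim_col (P * Q)"
      hence ab: "a < m" "b < m" by (auto simp: P_def Q_def)
      have "(P * Q) $$ (a, b) = (\<Sum>j = 0..<m. (if j < ns ! 0 then \<phi> 0 $$ (a, j) else 0) * B j b)"
        using ab by (simp add: P_def Q_def scalar_prod_def)
      also have "\<dots> = (\<Sum>j<ns ! 0. \<phi> 0 $$ (a, j) * B j b)"
        by (rule sum.mono_neutral_cong_right) (auto simp: m_def)
      finally show "M y $$ (a, b) = (P * Q) $$ (a, b)"
        using ab by (simp add: M_def y_ix)
    qed (auto simp: M_def P_def Q_def)
    moreover have "det P = 0"
    proof -
      have "P *\<^sub>v unit_vec m (ns ! 0) = 0\<^sub>v m"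
        by (rule eq_vecI) (auto simp: P_def m_def scalar_prod_right_unit)
      moreover have "unit_vec m (ns ! 0) \<noteq> (0\<^sub>v m :: 'a vec)"
        by (simp add: m_def)
      moreover have "unit_vec m (ns ! 0) \<in> carrier_vec m" by simp
      moreover have "P \<in> carrier_mat m m" by (simp add: P_def)
      ultimately show ?thesis using det_0_iff_vec_prod_zero_field[of P m] by blast
    qed
    ultimately show ?thesis
      using det_mult[of P m Q] by (simp add: f_def P_def Q_def)
  qed
  ultimately have "f \<in> vanishing_ideal (multi_indices (replicate d r)) (tensor_images ns r T)"
    by (simp add: vanishing_ideal_def)
  hence "f (unit_tensor d r) = 0"
    using cl unfolding zariski_closure_def zero_locus_def d_def by blast
  moreover have "M (unit_tensor d r) = 1\<^sub>m m"
  proof (rule eq_matI)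
    fix a b assume "a < dim_row (1\<^sub>m m :: 'a mat)" "b < dim_col (1\<^sub>m m :: 'a mat)"
    hence ab: "a < m" "b < m" by auto
    have "ix a b = replicate d i \<longleftrightarrow> a = i \<and> b = i" for i
    proof -
      obtain k where "d = Suc (Suc k)" using d2 by (metis add_2_eq_Suc le_Suc_ex)
      thus ?thesis by (simp add: ix_def) blast
    qed
    hence "unit_tensor d r (ix a b) = (\<Sum>i<r. if i = a then (if a = b then 1 else 0) else (0::'a))"
      unfolding unit_tensor_def by (intro sum.cong) auto
    thus "M (unit_tensor d r) $$ (a, b) = 1\<^sub>m m $$ (a, b)"
      using ab mr by (simp add: M_def)
  qed (auto simp: M_def)
  ultimately show False by (simp add: f_def)
qed

lemma unit_tensor_0_in_closure:
  assumes "length ns > 0"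
  shows "unit_tensor (length ns) 0
           \<in> zariski_closure (multi_indices (replicate (length ns) 0)) (tensor_images ns 0 T)"
proof -
  have "tensor_apply ns 0 (\<lambda>k. 0\<^sub>m 0 (ns ! k)) T \<in> tensor_images ns 0 T"
    by (auto simp: tensor_images_def)
  moreover have "tensor_apply ns 0 (\<lambda>k. 0\<^sub>m 0 (ns ! k)) T = unit_tensor (length ns) 0"
    using assms by (auto simp: tensor_apply_def unit_tensor_def multi_indices_replicate fun_eq_iff)
  ultimately show ?thesis
    by (auto simp: zariski_closure_def zero_locus_def vanishing_ideal_def coord_space_def
        unit_tensor_def)
qed

lemma border_subrank_le:
  assumes "length ns \<ge> 2"
  shows "unit_tensor (length ns) (border_subrank ns T) \<in>
           zariski_closure (multi_indices (replicate (length ns) (border_subrank ns T)))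
             (tensor_images ns (border_subrank ns T) T)"
    and "border_subrank ns T \<le> ns ! 0"
proof -
  show "unit_tensor (length ns) (border_subrank ns T) \<in>
          zariski_closure (multi_indices (replicate (length ns) (border_subrank ns T)))
            (tensor_images ns (border_subrank ns T) T)"
    unfolding border_subrank_def
    by (rule GreatestI_nat[where k = 0 and b = "ns ! 0"])
       (use assms in \<open>auto intro: unit_tensor_0_in_closure unit_tensor_in_closure_imp_le\<close>)
  from unit_tensor_in_closure_imp_le[OF assms this] show "border_subrank ns T \<le> ns ! 0" .
qed

lemma infinite_UNIV_alg_closed_field: "infinite (UNIV :: 'a::alg_closed_field set)"
proof
  assume fin: "finite (UNIV :: 'a set)"
  define q where "q = (\<Prod>a\<in>(UNIV :: 'a set). [:- a, 1:])"
  have "degree q = card (UNIV :: 'a set)"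
    unfolding q_def by (subst degree_prod_eq_sum_degree) auto
  moreover have "card (UNIV :: 'a set) > 0" using fin by (simp add: card_gt_0_iff)
  moreover have "degree (q + 1) = degree q"
    using calculation by (intro degree_add_eq_left) simp
  ultimately have "degree (q + 1) > 0" by simp
  then obtain z where "poly (q + 1) z = 0"
    using alg_closed_imp_poly_has_root by blast
  moreover have "poly q z = 0" using fin by (auto simp: q_def poly_prod)
  ultimately show False by simp
qed

lemma poly_fun_on_line:
  assumes "f \<in> poly_fun I"
  shows "\<exists>p. \<forall>t. f (\<lambda>i. x i + t * (y i - x i)) = poly p t"
  using assms
proof induction
  case (const c)
  show ?case by (rule exI[of _ "[:c:]"]) simp
next
  case (coord i)
  show ?case by (rule exI[of _ "[:x i, y i - x i:]"]) simp
next
  case (add f g)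
  then obtain p q where "\<forall>t. f (\<lambda>i. x i + t * (y i - x i)) = poly p t"
    "\<forall>t. g (\<lambda>i. x i + t * (y i - x i)) = poly q t" by blast
  thus ?case by (intro exI[of _ "p + q"]) simp
next
  case (mult f g)
  then obtain p q where "\<forall>t. f (\<lambda>i. x i + t * (y i - x i)) = poly p t"
    "\<forall>t. g (\<lambda>i. x i + t * (y i - x i)) = poly q t" by blast
  thus ?case by (intro exI[of _ "p * q"]) simp
qed

lemma coord_space_irreducible:
  fixes x y :: "'i \<Rightarrow> 'a::alg_closed_field"
  assumes "f \<in> poly_fun I" "g \<in> poly_fun I" "x \<in> coord_space I" "y \<in> coord_space I"
    and "f x \<noteq> 0" "g y \<noteq> 0"
  shows "\<exists>z\<in>coord_space I. f z * g z \<noteq> 0"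
proof -
  obtain p q where p: "\<And>t. f (\<lambda>i. x i + t * (y i - x i)) = poly p t"
    and q: "\<And>t. g (\<lambda>i. x i + t * (y i - x i)) = poly q t"
    using poly_fun_on_line[OF assms(1), of x y] poly_fun_on_line[OF assms(2), of x y] by blast
  have "p \<noteq> 0" "q \<noteq> 0" using p[of 0] q[of 1] assms(5,6) by auto
  hence "finite {t. poly (p * q) t = 0}" by (intro poly_roots_finite) auto
  hence "{t. poly (p * q) t = 0} \<noteq> UNIV"
    using infinite_UNIV_alg_closed_field[where 'a = 'a] by metis
  then obtain t where "poly (p * q) t \<noteq> 0" by blast
  hence "f (\<lambda>i. x i + t * (y i - x i)) * g (\<lambda>i. x i + t * (y i - x i)) \<noteq> 0"
    by (simp add: p q)
  moreover have "(\<lambda>i. x i + t * (y i - x i)) \<in> coord_space I"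
    using assms(3,4) by (simp add: coord_space_def)
  ultimately show ?thesis by blast
qed

lemma finite_cover_dense:
  fixes X :: "nat \<Rightarrow> ('i \<Rightarrow> 'a::alg_closed_field) set"
  assumes cover: "coord_space I = (\<Union>r\<le>N. X r)"
  shows "\<exists>r\<le>N. zariski_dense I (X r)"
proof (rule ccontr)
  assume nd: "\<not> (\<exists>r\<le>N. zariski_dense I (X r))"
  define vanish where "vanish = (\<lambda>(f :: ('i \<Rightarrow> 'a) \<Rightarrow> 'a) r. \<forall>x\<in>X r. f x = 0)"
  have *: "\<exists>f x. f \<in> poly_fun I \<and> vanish f r \<and> x \<in> coord_space I \<and> f x \<noteq> 0" if "r \<le> N" for r
  proof -
    have "X r \<subseteq> coord_space I" unfolding cover using that by (intro UN_upper) simp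
    hence "zariski_closure I (X r) \<noteq> coord_space I"
      using nd that by (simp add: zariski_dense_def)
    moreover have "zariski_closure I (X r) \<subseteq> coord_space I"
      by (simp add: zariski_closure_def zero_locus_def)
    ultimately obtain x where x: "x \<in> coord_space I" "x \<notin> zariski_closure I (X r)"
      by (meson subset_antisym subsetI)
    then obtain f where "f \<in> vanishing_ideal I (X r)" "f x \<noteq> 0"
      by (auto simp: zariski_closure_def zero_locus_def)
    with x(1) show ?thesis by (intro exI[of _ f] exI[of _ x]) (simp add: vanishing_ideal_def vanish_def)
  qed
  have "\<exists>f x. f \<in> poly_fun I \<and> (\<forall>r\<le>n. vanish f r) \<and> x \<in> coord_space I \<and> f x \<noteq> 0"
    if "n \<le> N" for n
    using that
  proof (induction n)
    case 0
    thus ?case using *[of 0] by simp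
  next
    case (Suc n)
    from Suc.prems have "n \<le> N" by simp
    from Suc.IH[OF this] obtain f x where
      f: "f \<in> poly_fun I" "\<forall>r\<le>n. vanish f r" "x \<in> coord_space I" "f x \<noteq> 0"
      by (elim exE conjE)
    from *[OF Suc.prems] obtain g y where
      g: "g \<in> poly_fun I" "vanish g (Suc n)" "y \<in> coord_space I" "g y \<noteq> 0"
      by (elim exE conjE)
    have "\<exists>z\<in>coord_space I. f z * g z \<noteq> 0"
      using coord_space_irreducible[of f I g x y] f g by simp
    then obtain z where z: "z \<in> coord_space I" "f z * g z \<noteq> 0" by (elim bexE)
    have "vanish (\<lambda>x. f x * g x) r" if "r \<le> Suc n" for r
    proof (cases "r = Suc n")
      case True
      thus ?thesis using g(2) by (simp add: vanish_def)
    next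
      case False
      hence "vanish f r" using f(2) that by simp
      thus ?thesis by (simp add: vanish_def)
    qed
    with z poly_fun.mult[OF f(1) g(1)] show ?case
      by (intro exI[of _ "\<lambda>x. f x * g x"] exI[of _ z]) simp
  qed
  from this[OF order.refl] obtain f x where
    f: "\<forall>r\<le>N. vanish f r" "x \<in> coord_space I" "f x \<noteq> 0"
    by (elim exE conjE)
  from f(2) obtain r where "r \<le> N" "x \<in> X r" unfolding cover by (elim UN_E) simp
  with f(1,3) show False by (simp add: vanish_def)
qed

lemma ex_is_generic_border_subrank:
  assumes "length ns \<ge> 2"
  shows "\<exists>r. is_generic_border_subrank TYPE('a::alg_closed_field) ns r"
proof -
  have "coord_space (multi_indices ns) =
      (\<Union>r\<le>ns ! 0. {T :: nat list \<Rightarrow> 'a. T \<in> tensors ns \<and> border_subrank ns T = r})"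
    using border_subrank_le(2)[OF assms] by (auto simp: tensors_def)
  from finite_cover_dense[OF this] show ?thesis
    by (auto simp: is_generic_border_subrank_def)
qed

end

(* Suppose that the unit tensor I_r is in the closure of the images of T. By Chevalley's extension
   theorem there is a place of the field generated by generic r x n matrices X_1, ..., X_d that
   sends (X_1, ..., X_d) T to I_r; it plays the role of a limit along a curve. Let d q < r. By
   elimination over its valuation ring, for each k there is a scalar c_k such that the row
   combinations of X_k divisible by c_k have coefficient vectors reducing to a space of codimension
   at most q in K^r, and such that the quotients by c_k reduce to a space of dimension at least q + 1
   in K^n. If the product of the c_k reduced to 0, then I_r, as a multilinear form, would vanish on
   a product of d spaces of codimension at most q, which is impossible as d q < r (slice rank). So
   the product has an inverse in the valuation ring, and dividing by it shows that restricting T to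
   the (q+1)-dimensional spaces gives a tensor of rank at most r. A dimension count now shows that a
   generic T with r <= n satisfies (q+1)^d <= d (q+1) (n + r), that is, r = O(n^(1/(d-1))). *)
theory Submission
  imports Defs "HOL-Computational_Algebra.Polynomial_Factorial"
begin

section \<open>Algebraic dependence\<close>

text \<open>The obstacle is that the entries of the X_k need not lie in the valuation ring: some
  rows may blow up while others tend to 0, so the maps cannot be reduced directly. Their behaviour
  is read off from a Smith normal form of X_k, each diagonal entry dividing the next. If c_k is
  entry number q, counted from 0, then all combinations of the rows from number q on are divisible
  by c_k, at the cost of codimension q in K^r; and if c_k is nonzero, the rows up to number q,
  scaled up to c_k, have q + 1 independent quotients. Hence one scalar serves both ends. The
  condition d q < r ensures that removing at most q positions for each of the d factors leaves one
  common to all. For the count, the (q+1)-dimensional spaces are given by matrices with an identity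
  in q + 1 columns. This makes (q+1)^d entries of T polynomial functions of its other entries, of d
  (q+1) n entries of the maps and of d (q+1) r entries of the rank decomposition.\<close>

lemma homogeneous_linear_system:
  fixes M :: "'e \<Rightarrow> 'u \<Rightarrow> 'a::field"
  assumes "finite E" "finite U" "card E < card U"
  shows "\<exists>c. (\<exists>u\<in>U. c u \<noteq> 0) \<and> (\<forall>e\<in>E. (\<Sum>u\<in>U. M e u * c u) = 0)"
  using assms
proof (induction E arbitrary: U M rule: finite_induct)
  case empty
  then obtain u where "u \<in> U" by fastforce
  then show ?case by (intro exI[of _ "\<lambda>_. 1"]) auto
next
  case (insert e E)
  show ?case
  proof (cases "\<forall>u\<in>U. M e u = 0")
    case True
    from insert have "card E < card U" by simp
    from insert.IH[OF insert.prems(1) this, of M] True show ?thesis by auto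
  next
    case False
    then obtain u0 where u0: "u0 \<in> U" "M e u0 \<noteq> 0" by blast
    let ?M' = "\<lambda>e' u. M e' u - M e' u0 * M e u / M e u0"
    from insert u0 have "finite (U - {u0})" "card E < card (U - {u0})" by auto
    from insert.IH[OF this, of ?M'] obtain c where
      c: "\<exists>u\<in>U - {u0}. c u \<noteq> 0" "\<And>e'. e' \<in> E \<Longrightarrow> (\<Sum>u\<in>U - {u0}. ?M' e' u * c u) = 0"
      by blast
    define s where "s = (\<Sum>u\<in>U - {u0}. M e u * c u) / M e u0"
    define c' where "c' = c(u0 := - s)"
    have sum_c': "(\<Sum>u\<in>U. M e' u * c' u) = (\<Sum>u\<in>U - {u0}. M e' u * c u) - M e' u0 * s" for e'
    proof -
      have "(\<Sum>u\<in>U. M e' u * c' u) = M e' u0 * c' u0 + (\<Sum>u\<in>U - {u0}. M e' u * c' u)"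
        using u0(1) insert.prems(1) by (rule sum.remove[rotated])
      also have "(\<Sum>u\<in>U - {u0}. M e' u * c' u) = (\<Sum>u\<in>U - {u0}. M e' u * c u)"
        by (rule sum.cong) (auto simp: c'_def)
      finally show ?thesis by (simp add: c'_def)
    qed
    have "(\<Sum>u\<in>U. M e' u * c' u) = 0" if "e' \<in> insert e E" for e'
    proof (cases "e' = e")
      case True
      then show ?thesis using u0(2) by (simp add: sum_c' s_def)
    next
      case False
      with that have "0 = (\<Sum>u\<in>U - {u0}. ?M' e' u * c u)" using c(2) by simp
      also have "\<dots> = (\<Sum>u\<in>U - {u0}. M e' u * c u) - M e' u0 * s"
        by (simp add: s_def algebra_simps sum_subtractf sum_distrib_left sum_divide_distrib)
      finally show ?thesis by (simp add: sum_c')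
    qed
    moreover have "\<exists>u\<in>U. c' u \<noteq> 0" using c(1) by (auto simp: c'_def)
    ultimately show ?thesis by blast
  qed
qed

section \<open>Degrees in single variables and vanishing on grids\<close>

definition poly_degree_le :: "'i set \<Rightarrow> nat \<Rightarrow> (('i \<Rightarrow> 'a::field) \<Rightarrow> 'a) \<Rightarrow> bool" where
  "poly_degree_le I n f \<longleftrightarrow>
     (\<forall>x. \<forall>i\<in>I. \<exists>p. degree p \<le> n \<and> (\<forall>t. f (x(i := t)) = poly p t))"

lemma poly_degree_le_const: "poly_degree_le I n (\<lambda>x. c)"
  unfolding poly_degree_le_def by (auto intro!: exI[of _ "[:c:]"])

lemma poly_degree_le_mono: "poly_degree_le I m f \<Longrightarrow> m \<le> n \<Longrightarrow> poly_degree_le I n f"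
  unfolding poly_degree_le_def by (meson le_trans)

lemma poly_degree_le_add:
  assumes "poly_degree_le I n f" "poly_degree_le I n g"
  shows "poly_degree_le I n (\<lambda>x. f x + g x)"
  unfolding poly_degree_le_def
proof (intro allI ballI)
  fix x i assume "i \<in> I"
  with assms obtain p q where "degree p \<le> n" "\<forall>t. f (x(i := t)) = poly p t"
    "degree q \<le> n" "\<forall>t. g (x(i := t)) = poly q t"
    unfolding poly_degree_le_def by meson
  then show "\<exists>p. degree p \<le> n \<and> (\<forall>t. f (x(i := t)) + g (x(i := t)) = poly p t)"
    by (intro exI[of _ "p + q"]) (simp add: degree_add_le)
qed

lemma poly_degree_le_mult:
  assumes "poly_degree_le I m f" "poly_degree_le I n g"
  shows "poly_degree_le I (m + n) (\<lambda>x. f x * g x)"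
  unfolding poly_degree_le_def
proof (intro allI ballI)
  fix x i assume "i \<in> I"
  with assms obtain p q where "degree p \<le> m" "\<forall>t. f (x(i := t)) = poly p t"
    "degree q \<le> n" "\<forall>t. g (x(i := t)) = poly q t"
    unfolding poly_degree_le_def by meson
  moreover from this have "degree (p * q) \<le> m + n"
    using degree_mult_le[of p q] by simp
  ultimately show "\<exists>p. degree p \<le> m + n \<and> (\<forall>t. f (x(i := t)) * g (x(i := t)) = poly p t)"
    by (intro exI[of _ "p * q"]) simp
qed

lemma poly_degree_le_sum:
  "(\<And>a. a \<in> A \<Longrightarrow> poly_degree_le I n (f a)) \<Longrightarrow> poly_degree_le I n (\<lambda>x. \<Sum>a\<in>A. f a x)"
  by (induction A rule: infinite_finite_induct)
     (auto intro: poly_degree_le_const poly_degree_le_add)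

lemma poly_degree_le_prod:
  "(\<And>a. a \<in> A \<Longrightarrow> poly_degree_le I n (f a)) \<Longrightarrow> poly_degree_le I (card A * n) (\<lambda>x. \<Prod>a\<in>A. f a x)"
  by (induction A rule: infinite_finite_induct)
     (auto intro: poly_degree_le_const poly_degree_le_mult)

lemma poly_fun_degree_le:
  fixes f :: "('i \<Rightarrow> 'a::field) \<Rightarrow> 'a"
  assumes "f \<in> poly_fun I"
  shows "\<exists>n. poly_degree_le J n f"
  using assms
proof induction
  case (const c)
  then show ?case by (auto intro: poly_degree_le_const)
next
  case (coord i)
  have "poly_degree_le J 1 (\<lambda>x :: 'i \<Rightarrow> 'a. x i)"
    unfolding poly_degree_le_def
  proof (intro allI ballI)
    fix x :: "'i \<Rightarrow> 'a" and j
    show "\<exists>p. degree p \<le> 1 \<and> (\<forall>t. (x(j := t)) i = poly p t)"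
    proof (cases "i = j")
      case True
      then show ?thesis by (intro exI[of _ "[:0, 1:]"]) simp
    next
      case False
      then show ?thesis by (intro exI[of _ "[:x i:]"]) simp
    qed
  qed
  then show ?case ..
next
  case (add f g)
  then obtain m n where "poly_degree_le J m f" "poly_degree_le J n g" by blast
  then have "poly_degree_le J (max m n) (\<lambda>x. f x + g x)"
    by (intro poly_degree_le_add) (auto intro: poly_degree_le_mono)
  then show ?case ..
next
  case (mult f g)
  then show ?case by (auto intro: poly_degree_le_mult)
qed

lemma poly_fun_cong:
  assumes "f \<in> poly_fun I" "\<And>i. i \<in> I \<Longrightarrow> x i = y i"
  shows "f x = f y"
  using assms by induction auto

lemma poly_fun_compose:
  assumes "f \<in> poly_fun I" "\<And>i. i \<in> I \<Longrightarrow> (\<lambda>x. g x i) \<in> poly_fun J"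
  shows "(\<lambda>x. f (g x)) \<in> poly_fun J"
  using assms by induction (auto intro: poly_fun.intros)

text \<open>The coordinates in \<open>J\<close> are released from the grid one at a time: in each,
  \<open>f\<close> is a univariate polynomial of degree at most \<open>n\<close> with more than
  \<open>n\<close> roots. This is why degrees are bounded in every variable separately.\<close>

lemma poly_fun_zero_if_zero_on_grid:
  assumes f: "poly_degree_le I n f" "f \<in> poly_fun I" and I: "finite I"
    and S: "card S > n" and zero: "\<And>x. x \<in> PiE I (\<lambda>_. S) \<Longrightarrow> f x = 0"
  shows "f x = 0"
proof -
  have "f x = 0" if "J \<subseteq> I" "\<And>i. i \<in> I - J \<Longrightarrow> x i \<in> S" for J x
    using finite_subset[OF that(1) I] that
  proof (induction J arbitrary: x rule: finite_induct)
    case empty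
    \<comment> \<open>\<open>f\<close> does not see the values outside \<open>I\<close>, so
      \<open>x\<close> may be made extensional.\<close>
    have "f x = f (restrict x I)" by (rule poly_fun_cong[OF f(2)]) simp
    also have "\<dots> = 0" using empty by (intro zero) auto
    finally show ?case .
  next
    case (insert i J)
    obtain p where p: "degree p \<le> n" "\<And>t. f (x(i := t)) = poly p t"
      using f(1) insert.prems(1) unfolding poly_degree_le_def by (metis insert_subset)
    have "poly p t = 0" if "t \<in> S" for t
      unfolding p(2)[symmetric] using insert.prems that by (intro insert.IH) auto
    then have sub: "S \<subseteq> {t. poly p t = 0}" by auto
    have "p = 0"
    proof (rule ccontr)
      assume "p \<noteq> 0"
      then have "card S \<le> card {t. poly p t = 0}" using sub by (intro card_mono poly_roots_finite)
      also have "\<dots> \<le> degree p" using \<open>p \<noteq> 0\<close> by (rule card_poly_roots_bound)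
      finally show False using S p(1) by simp
    qed
    then show ?case using p(2)[of "x i"] by simp
  qed
  from this[of I] show ?thesis by simp
qed

text \<open>The \<open>F\<close> are sought in the span of the Lagrange basis functions of a grid, so that a
  nontrivial coefficient is a nonzero value.\<close>

lemma algebraic_dependence:
  fixes g :: "'j \<Rightarrow> ('i \<Rightarrow> 'a::field) \<Rightarrow> 'a"
  assumes fin: "finite I" "finite J" and less: "card I < card J"
    and inf: "infinite (UNIV :: 'a set)"
    and g: "\<And>j. j \<in> J \<Longrightarrow> g j \<in> poly_fun I"
  shows "\<exists>F\<in>poly_fun J. (\<exists>y\<in>coord_space J. F y \<noteq> 0) \<and> (\<forall>x. F (\<lambda>j. g j x) = 0)"
proof -
  have "\<forall>j\<in>J. \<exists>n. poly_degree_le I n (g j)" using g poly_fun_degree_le by blast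
  then obtain D where D: "\<And>j. j \<in> J \<Longrightarrow> poly_degree_le I (D j) (g j)" by metis
  define m where "m = Max (insert 0 (D ` J))"
  have m: "poly_degree_le I m (g j)" if "j \<in> J" for j
    by (rule poly_degree_le_mono[OF D[OF that]]) (use that fin in \<open>simp add: m_def\<close>)
  \<comment> \<open>A polynomial of degree at most \<open>e\<close> in each variable from
    \<open>J\<close> has degree at most \<open>E\<close> in each variable from \<open>I\<close>
    after substituting the \<open>g j\<close>, so vanishing need only be imposed on a grid of side
    \<open>E + 1\<close>. Since \<open>E + 1\<close> is at most
    \<open>(e + 1) * (card J * m + 1)\<close>, this choice of \<open>e\<close> leaves fewer than
    \<open>(e + 1) ^ (card I + 1)\<close> equations, against \<open>(e + 1) ^ card J\<close>
    unknowns.\<close>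
  define e where "e = (card J * m + 1) ^ card I"
  define E where "E = card J * (e * m)"
  obtain S :: "'a set" where S: "finite S" "card S = Suc e"
    using infinite_arbitrarily_large[OF inf] by blast
  obtain R :: "'a set" where R: "finite R" "card R = Suc E"
    using infinite_arbitrarily_large[OF inf] by blast
  define L where "L = (\<lambda>u (y :: 'j \<Rightarrow> 'a). \<Prod>j\<in>J. \<Prod>b\<in>S - {u j}. y j - b)"
  let ?U = "PiE J (\<lambda>_. S)" and ?E = "PiE I (\<lambda>_. R)"
  have "card ?E = Suc E ^ card I" using fin R by (simp add: card_PiE)
  also have "\<dots> \<le> (Suc e * (card J * m + 1)) ^ card I"
    by (rule power_mono) (auto simp: E_def algebra_simps)
  also have "\<dots> = Suc e ^ card I * e" by (simp only: power_mult_distrib e_def)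
  also have "\<dots> < Suc e ^ Suc (card I)" by simp
  also have "\<dots> \<le> Suc e ^ card J" using less by (intro power_increasing) auto
  also have "\<dots> = card ?U" using fin S by (simp add: card_PiE)
  finally have "card ?E < card ?U" .
  with fin S R have "\<exists>c. (\<exists>u\<in>?U. c u \<noteq> 0) \<and> (\<forall>x\<in>?E. (\<Sum>u\<in>?U. L u (\<lambda>j. g j x) * c u) = 0)"
    by (intro homogeneous_linear_system finite_PiE) auto
  then obtain c u0 where u0: "u0 \<in> ?U" "c u0 \<noteq> 0"
    and c: "\<And>x. x \<in> ?E \<Longrightarrow> (\<Sum>u\<in>?U. L u (\<lambda>j. g j x) * c u) = 0" by blast
  define F where "F = (\<lambda>y. \<Sum>u\<in>?U. L u y * c u)"
  have diff: "(\<lambda>x. f x - b) \<in> poly_fun A" if "f \<in> poly_fun A"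
    for f :: "('k \<Rightarrow> 'a) \<Rightarrow> 'a" and A b
    using poly_fun.add[OF that poly_fun.const[of "-b"]] by simp
  have F: "F \<in> poly_fun J"
    unfolding F_def L_def
    by (intro poly_fun_sum poly_fun.mult poly_fun_prod poly_fun.const diff poly_fun.coord)
  \<comment> \<open>\<open>u0\<close> is \<open>undefined\<close> outside \<open>J\<close>, whereas
    points of \<open>coord_space J\<close> are 0 there.\<close>
  define y0 where "y0 = (\<lambda>j. if j \<in> J then u0 j else 0)"
  have "L u y0 = 0" if "u \<in> ?U - {u0}" for u
  proof -
    have u: "u \<in> ?U" "u \<noteq> u0" using that by simp_all
    have "\<exists>j\<in>J. u j \<noteq> u0 j"
    proof (rule ccontr)
      assume "\<not> (\<exists>j\<in>J. u j \<noteq> u0 j)"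
      then have "u = u0" by (intro PiE_ext[OF u(1) u0(1)]) simp
      with u(2) show False ..
    qed
    then obtain j where "j \<in> J" "u j \<noteq> u0 j" by (elim bexE)
    moreover from u0(1) \<open>j \<in> J\<close> have "u0 j \<in> S" by (rule PiE_mem)
    ultimately have "(\<Prod>b\<in>S - {u j}. y0 j - b) = 0"
      using S(1) by (intro prod_zero) (auto simp: y0_def)
    with \<open>j \<in> J\<close> fin show ?thesis unfolding L_def by (intro prod_zero) auto
  qed
  then have "F y0 = L u0 y0 * c u0"
    unfolding F_def using fin S u0(1)
    by (subst sum.remove[of _ u0]) (simp_all add: finite_PiE)
  moreover have "L u0 y0 \<noteq> 0" using fin S by (auto simp: L_def y0_def)
  ultimately have "F y0 \<noteq> 0" using u0(2) by simp
  moreover have "y0 \<in> coord_space J" by (simp add: coord_space_def y0_def)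
  moreover have "F (\<lambda>j. g j x) = 0" for x
  proof (rule poly_fun_zero_if_zero_on_grid[where f = "\<lambda>x. F (\<lambda>j. g j x)"])
    show "(\<lambda>x. F (\<lambda>j. g j x)) \<in> poly_fun I"
      using F g by (rule poly_fun_compose)
    have gb: "poly_degree_le I m (\<lambda>x. g j x - b)" if "j \<in> J" for j b
      using poly_degree_le_add[OF m[OF that] poly_degree_le_const[of I m "-b"]] by simp
    have "poly_degree_le I E (\<lambda>x. L u (\<lambda>j. g j x))" if "u \<in> ?U" for u
      unfolding L_def E_def
    proof (rule poly_degree_le_prod)
      fix j assume j: "j \<in> J"
      with that have "u j \<in> S" by auto
      then have "card (S - {u j}) = e" using S by simp
      then show "poly_degree_le I (e * m) (\<lambda>x. \<Prod>b\<in>S - {u j}. g j x - b)"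
        using poly_degree_le_prod[of "S - {u j}" I m "\<lambda>b x. g j x - b"] gb[OF j] by simp
    qed
    then have "poly_degree_le I (E + 0) (\<lambda>x. L u (\<lambda>j. g j x) * c u)" if "u \<in> ?U" for u
      using that by (intro poly_degree_le_mult poly_degree_le_const)
    then show "poly_degree_le I E (\<lambda>x. F (\<lambda>j. g j x))"
      unfolding F_def by (intro poly_degree_le_sum) simp
    show "card R > E" using R by simp
    show "F (\<lambda>j. g j x) = 0" if "x \<in> ?E" for x using c[OF that] by (simp add: F_def)
  qed (rule fin)
  ultimately show ?thesis using F by blast
qed

section \<open>Extension of places\<close>

locale field_embedding =
  fixes emb :: "'a::field \<Rightarrow> 'l::field"
  assumes emb_0 [simp]: "emb 0 = 0" and emb_1 [simp]: "emb 1 = 1"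
    and emb_add: "emb (a + b) = emb a + emb b"
    and emb_mult: "emb (a * b) = emb a * emb b"
begin

text \<open>Partial homomorphisms from subalgebras of \<open>'l\<close> to \<open>'a\<close> are given by their graphs; a
  subalgebra of the product is such a graph unless it contains \<open>(0, 1)\<close>.\<close>

definition subalgebra :: "('l \<times> 'a) set \<Rightarrow> bool" where
  "subalgebra G \<longleftrightarrow> (\<forall>c. (emb c, c) \<in> G) \<and>
     (\<forall>x a y b. (x, a) \<in> G \<longrightarrow> (y, b) \<in> G \<longrightarrow> (x + y, a + b) \<in> G \<and> (x * y, a * b) \<in> G)"

text \<open>This is reduction of polynomials coefficient by coefficient. In particular,
  \<open>lifts G p 1\<close> means that \<open>p - 1\<close> reduces to 0; a root \<open>x\<close>
  of such a \<open>p\<close> cannot be given any value, since the value would satisfy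
  \<open>1 = 0\<close>.\<close>

definition lifts :: "('l \<times> 'a) set \<Rightarrow> 'l poly \<Rightarrow> 'a poly \<Rightarrow> bool" where
  "lifts G p q \<longleftrightarrow> (\<forall>i. (coeff p i, coeff q i) \<in> G)"

lemma emb_uminus: "emb (- a) = - emb a"
  using emb_add[of a "-a"] by (simp add: eq_neg_iff_add_eq_0 add.commute)

context
  fixes G assumes G: "subalgebra G"
begin

lemma subalgebra_emb: "(emb c, c) \<in> G"
  using G by (simp add: subalgebra_def)

lemma subalgebra_add: "(x, a) \<in> G \<Longrightarrow> (y, b) \<in> G \<Longrightarrow> (x + y, a + b) \<in> G"
  using G by (simp add: subalgebra_def)

lemma subalgebra_mult: "(x, a) \<in> G \<Longrightarrow> (y, b) \<in> G \<Longrightarrow> (x * y, a * b) \<in> G"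
  using G by (simp add: subalgebra_def)

lemma subalgebra_zero: "(0, 0) \<in> G" and subalgebra_one: "(1, 1) \<in> G"
  using subalgebra_emb[of 0] subalgebra_emb[of 1] by simp_all

lemma subalgebra_uminus: "(x, a) \<in> G \<Longrightarrow> (- x, - a) \<in> G"
  using subalgebra_mult[OF subalgebra_emb[of "-1"], of x a] by (simp add: emb_uminus)

lemma subalgebra_diff: "(x, a) \<in> G \<Longrightarrow> (y, b) \<in> G \<Longrightarrow> (x - y, a - b) \<in> G"
  using subalgebra_add[OF _ subalgebra_uminus, of x a y b] by simp

lemma subalgebra_power: "(x, a) \<in> G \<Longrightarrow> (x ^ n, a ^ n) \<in> G"
  by (induction n) (auto intro: subalgebra_mult subalgebra_one)

lemma subalgebra_sum:
  "(\<And>i. i \<in> I \<Longrightarrow> (x i, a i) \<in> G) \<Longrightarrow> ((\<Sum>i\<in>I. x i), (\<Sum>i\<in>I. a i)) \<in> G"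
  by (induction I rule: infinite_finite_induct) (auto intro: subalgebra_add subalgebra_zero)

lemma liftsD: "lifts G p q \<Longrightarrow> (coeff p i, coeff q i) \<in> G"
  by (simp add: lifts_def)

lemma lifts_add: "lifts G p q \<Longrightarrow> lifts G p' q' \<Longrightarrow> lifts G (p + p') (q + q')"
  by (simp add: lifts_def subalgebra_add)

lemma lifts_diff: "lifts G p q \<Longrightarrow> lifts G p' q' \<Longrightarrow> lifts G (p - p') (q - q')"
  by (simp add: lifts_def subalgebra_diff)

lemma lifts_mult: "lifts G p q \<Longrightarrow> lifts G p' q' \<Longrightarrow> lifts G (p * p') (q * q')"
  by (auto simp: lifts_def coeff_mult intro!: subalgebra_sum subalgebra_mult)

lemma lifts_monom: "(x, a) \<in> G \<Longrightarrow> lifts G (monom x n) (monom a n)"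
  by (simp add: lifts_def subalgebra_zero)

lemma lifts_const: "(x, a) \<in> G \<Longrightarrow> lifts G [:x:] [:a:]"
  using lifts_monom[of x a 0] by (simp add: monom_0)

lemma lifts_map_emb: "lifts G (map_poly emb q) q"
  by (simp add: lifts_def coeff_map_poly subalgebra_emb)

end

lemma adjoin_subalgebra:
  assumes G: "subalgebra G"
  shows "subalgebra {(poly p x, poly q a) | p q. lifts G p q}" (is "subalgebra ?H")
    and "G \<subseteq> {(poly p x, poly q a) | p q. lifts G p q}"
    and "(x, a) \<in> {(poly p x, poly q a) | p q. lifts G p q}"
proof -
  show sub: "G \<subseteq> ?H"
  proof
    fix z assume z: "z \<in> G"
    then show "z \<in> ?H"
      using lifts_const[OF G, of "fst z" "snd z"]
      by (auto intro!: exI[of _ "[:fst z:]"] exI[of _ "[:snd z:]"])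
  qed
  show "(x, a) \<in> ?H"
    using lifts_monom[OF G subalgebra_one[OF G], of 1]
    by (auto intro!: exI[of _ "monom 1 1"] simp: poly_monom)
  have "(y + y', b + b') \<in> ?H \<and> (y * y', b * b') \<in> ?H"
    if "(y, b) \<in> ?H" "(y', b') \<in> ?H" for y b y' b'
  proof -
    from that obtain p q p' q' where *: "lifts G p q" "lifts G p' q'"
      "y = poly p x" "b = poly q a" "y' = poly p' x" "b' = poly q' a" by blast
    have "(y + y', b + b') = (poly (p + p') x, poly (q + q') a)"
      "(y * y', b * b') = (poly (p * p') x, poly (q * q') a)"
      by (simp_all add: *)
    with lifts_add[OF G *(1,2)] lifts_mult[OF G *(1,2)] show ?thesis by blast
  qed
  moreover have "(emb c, c) \<in> ?H" for c using sub subalgebra_emb[OF G] by blast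
  ultimately show "subalgebra ?H" unfolding subalgebra_def by blast
qed

end

section \<open>Chevalley's argument: maximal partial homomorphisms live on valuation rings\<close>

locale maximal_subalgebra = field_embedding emb
  for emb :: "'a::alg_closed_field \<Rightarrow> 'l::field" +
  fixes G
  assumes G: "subalgebra G" and proper: "(0, 1) \<notin> G"
    and maximal: "\<And>H. subalgebra H \<Longrightarrow> (0, 1) \<notin> H \<Longrightarrow> G \<subseteq> H \<Longrightarrow> H = G"
begin

text \<open>Multiplication by the constant \<open>inverse a\<close> would turn \<open>(0, a)\<close>
  with nonzero \<open>a\<close> into \<open>(0, 1)\<close>. Excluding this single pair therefore
  makes \<open>G\<close> single-valued.\<close>

lemma zero_fst: "(0, a) \<in> G \<Longrightarrow> a = 0"
  using subalgebra_mult[OF G subalgebra_emb[OF G, of "inverse a"], of 0 a] proper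
  by (cases "a = 0") auto

lemma single_valued: "(x, a) \<in> G \<Longrightarrow> (x, b) \<in> G \<Longrightarrow> a = b"
  using zero_fst[of "a - b"] subalgebra_diff[OF G, of x a x b] by simp

text \<open>The reductions of the relations satisfied by \<open>x\<close> form an ideal; if it is proper, then \<open>x\<close> can
  be mapped to a common root.\<close>

lemma extend:
  assumes x: "\<And>p. lifts G p 1 \<Longrightarrow> poly p x \<noteq> 0"
  shows "\<exists>a. (x, a) \<in> G"
proof -
  define J where "J = {q. \<exists>p. lifts G p q \<and> poly p x = 0}"
  have J_diff: "q - s * q' \<in> J" if "q \<in> J" "q' \<in> J" for q q' s
  proof -
    from that obtain p p' where "lifts G p q" "poly p x = 0" "lifts G p' q'" "poly p' x = 0"
      by (auto simp: J_def)
    then show ?thesis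
      unfolding J_def
      by (auto intro!: exI[of _ "p - map_poly emb s * p'"] lifts_diff lifts_mult lifts_map_emb G)
  qed
  have "1 \<notin> J" using x by (auto simp: J_def)
  have "\<exists>a. \<forall>q\<in>J. poly q a = 0"
  proof (cases "J \<subseteq> {0}")
    case True
    then show ?thesis by (intro exI[of _ 0]) auto
  next
    case False
    then have "\<exists>q. q \<in> J \<and> q \<noteq> 0" by blast
    from ex_has_least_nat[where P = "\<lambda>q. q \<in> J \<and> q \<noteq> 0" and m = degree] this
    obtain q where q: "q \<in> J" "q \<noteq> 0" and
      least: "\<And>q'. q' \<in> J \<Longrightarrow> q' \<noteq> 0 \<Longrightarrow> degree q \<le> degree q'" by blast
    have dvd: "q dvd q'" if "q' \<in> J" for q'
    proof -
      have "q' - (q' div q) * q \<in> J" by (rule J_diff[OF that q(1)])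
      then have "q' mod q \<in> J" by (simp add: minus_div_mult_eq_mod)
      then have "q' mod q = 0" using least[of "q' mod q"] degree_mod_less[OF q(2), of q'] by fastforce
      then show ?thesis by blast
    qed
    have "degree q \<noteq> 0"
    proof
      assume "degree q = 0"
      then obtain c where c: "q = [:c:]" by (metis degree_eq_zeroE)
      with q(2) have "c \<noteq> 0" by simp
      \<comment> \<open>\<open>J_diff\<close> only subtracts multiples, so the scaling of
        \<open>q\<close> by \<open>inverse c\<close> is written as a difference.\<close>
      have "q - [:1 - inverse c:] * q \<in> J" by (rule J_diff) (use q in auto)
      also have "q - [:1 - inverse c:] * q = 1" using \<open>c \<noteq> 0\<close> by (simp add: c algebra_simps one_pCons)
      finally show False using \<open>1 \<notin> J\<close> by simp
    qed
    then obtain a where "poly q a = 0"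
      using alg_closed_imp_poly_has_root[of q] by blast
    then have "poly q' a = 0" if "q' \<in> J" for q'
      using dvd[OF that] by (auto elim!: dvdE)
    then show ?thesis by blast
  qed
  then obtain a where a: "\<And>q. q \<in> J \<Longrightarrow> poly q a = 0" by blast
  \<comment> \<open>\<open>?H\<close> omits \<open>(0, 1)\<close> because every relation for
    \<open>x\<close> reduces to a polynomial vanishing at \<open>a\<close>; maximality then puts
    \<open>(x, a)\<close> into \<open>G\<close>.\<close>
  let ?H = "{(poly p x, poly q a) | p q. lifts G p q}"
  have "(0, 1) \<notin> ?H"
  proof
    assume "(0, 1) \<in> ?H"
    then obtain p q where "lifts G p q" "poly p x = 0" "poly q a = 1" by auto
    then show False using a[of q] by (auto simp: J_def)
  qed
  then have "?H = G" using adjoin_subalgebra[OF G] by (intro maximal)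
  then show ?thesis using adjoin_subalgebra(3)[OF G, of x a] by blast
qed

text \<open>Clearing denominators: \<open>u ^ n\<close> times a relation of degree \<open>n\<close>
  for \<open>inverse u\<close> is an expression in \<open>u\<close> that reduces to
  \<open>b ^ n\<close>, which is nonzero. So there is no such relation and \<open>extend\<close>
  applies.\<close>

lemma unit_inverse:
  assumes "(u, b) \<in> G" "b \<noteq> 0"
  shows "(inverse u, inverse b) \<in> G"
proof -
  have u: "u \<noteq> 0" using assms zero_fst by auto
  have "\<exists>a. (inverse u, a) \<in> G"
  proof (rule extend)
    fix p assume p: "lifts G p 1"
    show "poly p (inverse u) \<noteq> 0"
    proof
      assume zero: "poly p (inverse u) = 0"
      let ?n = "degree p"
      have "((\<Sum>i\<le>?n. coeff p i * u ^ (?n - i)), (\<Sum>i\<le>?n. coeff 1 i * b ^ (?n - i))) \<in> G"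
        by (intro subalgebra_sum[OF G] subalgebra_mult[OF G] subalgebra_power[OF G]
            liftsD[OF G p] assms(1))
      also have "(\<Sum>i\<le>?n. coeff p i * u ^ (?n - i)) = u ^ ?n * poly p (inverse u)"
        unfolding poly_altdef sum_distrib_left using u
        by (intro sum.cong) (auto simp: power_diff field_simps power_inverse)
      also have "\<dots> = 0" using zero by simp
      also have "(\<Sum>i\<le>?n. coeff 1 i * b ^ (?n - i)) = b ^ ?n"
        by (simp add: coeff_1 if_distrib[of "\<lambda>x. x * _"] sum.delta cong: if_cong)
      finally show False using zero_fst[of "b ^ ?n"] assms(2) by simp
    qed
  qed
  then obtain a where a: "(inverse u, a) \<in> G" ..
  with assms(1) have "(1, b * a) \<in> G" using subalgebra_mult[OF G assms(1) a] u by simp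
  then have "b * a = 1" using single_valued subalgebra_one[OF G] by blast
  then have "a = inverse b" by (simp add: inverse_unique)
  with a show ?thesis by simp
qed

lemma relation_degree_pos:
  assumes "lifts G p 1" "poly p x = 0"
  shows "degree p > 0"
proof (rule ccontr)
  assume "\<not> ?thesis"
  then have "p = 0" using assms(2) by (auto elim!: degree_eq_zeroE)
  then show False using liftsD[OF G assms(1), of 0] proper by simp
qed

text \<open>Multiplied by \<open>x ^ n\<close>, the relation \<open>p'\<close> for
  \<open>inverse x\<close> becomes a relation for \<open>x\<close> of degree \<open>n\<close> whose
  leading coefficient \<open>u\<close> reduces to 1 and whose other coefficients reduce to 0. The
  leading coefficient of \<open>p\<close> reduces to 0, so cancelling it by a multiple of the new
  relation changes no reduction.\<close>

lemma relation_reduce: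
  assumes p: "lifts G p 1" "poly p x = 0" and p': "lifts G p' 1" "poly p' (inverse x) = 0"
    and deg: "degree p' \<le> degree p" and x: "x \<noteq> 0"
  shows "\<exists>p2. lifts G p2 1 \<and> poly p2 x = 0 \<and> degree p2 < degree p"
proof -
  define u where "u = coeff p' 0"
  define m n where "m = degree p" and "n = degree p'"
  have m: "m > 0" and n: "n > 0"
    using relation_degree_pos[OF p] relation_degree_pos[OF p'] by (simp_all add: m_def n_def)
  have u: "(u, 1) \<in> G" using liftsD[OF G p'(1), of 0] by (simp add: u_def)
  then have u0: "u \<noteq> 0" using proper by auto
  from unit_inverse[OF u] have iu: "(inverse u, 1) \<in> G" by simp
  have lead: "(coeff p m, 0) \<in> G" using liftsD[OF G p(1), of m] m by (simp add: coeff_1)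
  define c where "c = coeff p m * inverse u"
  have c: "(c, 0) \<in> G" using subalgebra_mult[OF G lead iu] by (simp add: c_def)
  define h where "h = monom c (m - n) * reflect_poly p'"
  have refl: "lifts G (reflect_poly p') (monom 1 n)"
    unfolding lifts_def
  proof
    fix i
    have "(coeff p' (n - i), coeff 1 (n - i)) \<in> G" using p'(1) by (rule liftsD[OF G])
    then show "(coeff (reflect_poly p') i, coeff (monom 1 n) i) \<in> G"
      by (cases "n < i"; cases "n = i")
         (auto simp: coeff_reflect_poly n_def[symmetric] coeff_1 subalgebra_zero[OF G])
  qed
  have h: "lifts G h 0"
    using lifts_mult[OF G lifts_monom[OF G c, of "m - n"] refl] by (simp add: h_def)
  have "poly (reflect_poly p') x = 0"
    using poly_reflect_poly_nz[OF x, of p'] p'(2) by simp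
  then have "poly (p - h) x = 0" using p(2) by (simp add: h_def)
  moreover have "lifts G (p - h) 1" using lifts_diff[OF G p(1) h] by simp
  moreover have "degree (p - h) < m"
  proof (rule degree_lessI)
    show "\<forall>k\<ge>m. coeff (p - h) k = 0"
    proof safe
      fix k assume k: "m \<le> k"
      have "coeff h k = c * coeff (reflect_poly p') (k - (m - n))"
        using k by (simp add: h_def coeff_monom_mult)
      moreover have "k - (m - n) = k - m + n" using k deg by (simp add: m_def n_def)
      ultimately show "coeff (p - h) k = 0"
        using k u0 by (cases "k = m")
          (auto simp: coeff_reflect_poly n_def[symmetric] c_def u_def[symmetric] m_def coeff_eq_0)
    qed
  qed (use m in simp)
  ultimately show ?thesis by (auto simp: m_def)
qed

text \<open>Descent on the sum of the degrees: the situation is symmetric in \<open>x\<close> and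
  \<open>inverse x\<close>, and whichever relation is not the shorter one can be shortened by the
  other.\<close>

lemma no_relations_both:
  assumes "lifts G p 1" "poly p x = 0" "lifts G p' 1" "poly p' (inverse x) = 0" "x \<noteq> 0"
  shows False
  using assms
proof (induction "degree p + degree p'" arbitrary: p p' rule: less_induct)
  case less
  show ?case
  proof (cases "degree p' \<le> degree p")
    case True
    from relation_reduce[OF less.prems(1-4) True less.prems(5)] less.hyps[of _ p'] less.prems
    show ?thesis by auto
  next
    case False
    from relation_reduce[OF less.prems(3,4,1), of] False less.hyps[of p] less.prems
    show ?thesis by auto
  qed
qed

lemma valuation: "(\<exists>a. (x, a) \<in> G) \<or> x \<noteq> 0 \<and> (inverse x, 0) \<in> G"
proof (cases "x = 0")
  case True
  then show ?thesis using subalgebra_zero[OF G] by blast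
next
  case False
  show ?thesis
  proof (cases "\<exists>p. lifts G p 1 \<and> poly p x = 0")
    case True
    then have "\<exists>a. (inverse x, a) \<in> G" using no_relations_both[of _ x] False by (intro extend) blast
    then obtain a where "(inverse x, a) \<in> G" ..
    then show ?thesis using False unit_inverse[of "inverse x" a] by (cases "a = 0") auto
  next
    case nex: False
    then show ?thesis using extend[of x] by blast
  qed
qed

end

text \<open>A place of \<open>'l\<close> with values in \<open>'a\<close> that fixes the constants,
  in the form of its valuation ring \<open>R\<close> and residue map \<open>res\<close>. Elements
  outside \<open>R\<close> are those sent to infinity.\<close>

locale place = field_embedding emb
  for emb :: "'a::field \<Rightarrow> 'l::field" +
  fixes R :: "'l set" and res :: "'l \<Rightarrow> 'a"
  assumes emb_in: "emb c \<in> R" and res_emb: "res (emb c) = c"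
    and add_in: "x \<in> R \<Longrightarrow> y \<in> R \<Longrightarrow> x + y \<in> R"
    and res_add: "x \<in> R \<Longrightarrow> y \<in> R \<Longrightarrow> res (x + y) = res x + res y"
    and mult_in: "x \<in> R \<Longrightarrow> y \<in> R \<Longrightarrow> x * y \<in> R"
    and res_mult: "x \<in> R \<Longrightarrow> y \<in> R \<Longrightarrow> res (x * y) = res x * res y"
    and total: "x \<in> R \<or> x \<noteq> 0 \<and> inverse x \<in> R \<and> res (inverse x) = 0"

text \<open>The union of a chain of subalgebras omits \<open>(0, 1)\<close> if all its members do,
  so Zorn's lemma provides a maximal one, and \<open>valuation\<close> turns it into a
  place.\<close>

theorem place_extension:
  fixes emb :: "'a::alg_closed_field \<Rightarrow> 'l::field"
  assumes emb: "field_embedding emb"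
    and G0: "field_embedding.subalgebra emb G0" "(0, 1) \<notin> G0"
  shows "\<exists>R res. place emb R res \<and> (\<forall>(x, a)\<in>G0. x \<in> R \<and> res x = a)"
proof -
  interpret field_embedding emb by (rule emb)
  let ?A = "{H. subalgebra H \<and> (0, 1) \<notin> H \<and> G0 \<subseteq> H}"
  have "\<exists>G\<in>?A. \<forall>H\<in>?A. G \<subseteq> H \<longrightarrow> H = G"
  proof (rule subset_Zorn_nonempty)
    show "?A \<noteq> {}" using G0 by blast
    fix C assume ne: "C \<noteq> {}" and C: "subset.chain ?A C"
    have mem: "subalgebra H" "(0, 1) \<notin> H" "G0 \<subseteq> H" if "H \<in> C" for H
      using C that by (auto simp: subset.chain_def)
    have "(x + y, a + b) \<in> \<Union>C \<and> (x * y, a * b) \<in> \<Union>C"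
      if "(x, a) \<in> \<Union>C" "(y, b) \<in> \<Union>C" for x a y b
    proof -
      from that obtain H H' where H: "H \<in> C" "(x, a) \<in> H" "H' \<in> C" "(y, b) \<in> H'" by blast
      with C have "H \<subseteq> H' \<or> H' \<subseteq> H" unfolding subset_chain_def by blast
      with H obtain H'' where "H'' \<in> C" "(x, a) \<in> H''" "(y, b) \<in> H''" by blast
      then show ?thesis
        using subalgebra_add[OF mem(1)[of H'']] subalgebra_mult[OF mem(1)[of H'']] by blast
    qed
    moreover have "(emb c, c) \<in> \<Union>C" for c using ne mem(1) by (auto simp: subalgebra_def)
    ultimately have "subalgebra (\<Union>C)" unfolding subalgebra_def by blast
    moreover have "(0, 1) \<notin> \<Union>C" using mem(2) by blast
    moreover have "G0 \<subseteq> \<Union>C" using ne mem(3) by blast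
    ultimately show "\<Union>C \<in> ?A" by simp
  qed
  then obtain G where "G \<in> ?A" and max': "\<forall>H\<in>?A. G \<subseteq> H \<longrightarrow> H = G" by (elim bexE)
  then have G: "subalgebra G" "(0, 1) \<notin> G" and G0_sub: "G0 \<subseteq> G" by simp_all
  then have max: "H = G" if "subalgebra H" "(0, 1) \<notin> H" "G \<subseteq> H" for H
    using bspec[OF max', of H] that by simp
  interpret maximal_subalgebra emb G
    by (intro maximal_subalgebra.intro maximal_subalgebra_axioms.intro emb G(1,2)) (rule max)
  define R where "R = fst ` G"
  define res where "res = (\<lambda>x. THE a. (x, a) \<in> G)"
  have res_eq: "x \<in> R \<and> res x = a" if "(x, a) \<in> G" for x a
  proof
    show "x \<in> R" unfolding R_def using that by (rule image_eqI[rotated]) simp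
    show "res x = a" unfolding res_def using that single_valued[OF _ that] by (rule the_equality)
  qed
  have in_G: "(x, res x) \<in> G" if "x \<in> R" for x
  proof -
    from that obtain a where "(x, a) \<in> G" unfolding R_def by force
    with res_eq[OF this] show ?thesis by simp
  qed
  have "place emb R res"
  proof
    show "x \<in> R \<or> x \<noteq> 0 \<and> inverse x \<in> R \<and> res (inverse x) = 0" for x
      using valuation[of x] res_eq by blast
    show "emb c \<in> R" "res (emb c) = c" for c
      using res_eq[OF subalgebra_emb[OF G(1)]] by simp_all
    fix x y assume "x \<in> R" "y \<in> R"
    then have xy: "(x, res x) \<in> G" "(y, res y) \<in> G" by (simp_all add: in_G)
    show "x + y \<in> R" "res (x + y) = res x + res y" "x * y \<in> R" "res (x * y) = res x * res y"
      using res_eq[OF subalgebra_add[OF G(1) xy]] res_eq[OF subalgebra_mult[OF G(1) xy]]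
      by simp_all
  qed
  moreover have "x \<in> R \<and> res x = a" if "(x, a) \<in> G0" for x a
    using that G0_sub res_eq by blast
  ultimately show ?thesis by blast
qed

section \<open>Elimination over a valuation ring\<close>

context place
begin

lemma zero_in: "0 \<in> R" and res_0: "res 0 = 0"
  using emb_in[of 0] res_emb[of 0] by simp_all

lemma one_in: "1 \<in> R" and res_1: "res 1 = 1"
  using emb_in[of 1] res_emb[of 1] by simp_all

lemma uminus_in: "x \<in> R \<Longrightarrow> - x \<in> R"
  using mult_in[OF emb_in[of "-1"], of x] by (simp add: emb_uminus)

lemma diff_in: "x \<in> R \<Longrightarrow> y \<in> R \<Longrightarrow> x - y \<in> R"
  using add_in[OF _ uminus_in, of x y] by simp

lemma sum_in: "(\<And>i. i \<in> I \<Longrightarrow> x i \<in> R) \<Longrightarrow> (\<Sum>i\<in>I. x i) \<in> R"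
  by (induction I rule: infinite_finite_induct) (auto intro: zero_in add_in)

lemma res_sum: "(\<And>i. i \<in> I \<Longrightarrow> x i \<in> R) \<Longrightarrow> res (\<Sum>i\<in>I. x i) = (\<Sum>i\<in>I. res (x i))"
  by (induction I rule: infinite_finite_induct) (auto simp: res_0 res_add sum_in)

lemma prod_in: "(\<And>i. i \<in> I \<Longrightarrow> x i \<in> R) \<Longrightarrow> (\<Prod>i\<in>I. x i) \<in> R"
  by (induction I rule: infinite_finite_induct) (auto intro: one_in mult_in)

lemma res_prod: "(\<And>i. i \<in> I \<Longrightarrow> x i \<in> R) \<Longrightarrow> res (\<Prod>i\<in>I. x i) = (\<Prod>i\<in>I. res (x i))"
  by (induction I rule: infinite_finite_induct) (auto simp: res_1 res_mult prod_in)

lemma inverse_in: "x \<in> R \<Longrightarrow> res x \<noteq> 0 \<Longrightarrow> inverse x \<in> R"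
  using total[of "inverse x"] by auto

text \<open>Divisibility with quotients in a valuation ring is a total preorder on the whole field.
  The elements compared may lie outside \<open>R\<close>, as the entries of the generic matrices
  may.\<close>

lemma ex_dominant:
  assumes "finite E" "E \<noteq> {}"
  shows "\<exists>D\<in>E. \<forall>x\<in>E. \<exists>t\<in>R. x = t * D"
  using assms
proof (induction E rule: finite_ne_induct)
  case (singleton x)
  then show ?case using one_in by auto
next
  case (insert x E)
  then obtain D where D: "D \<in> E" and dom: "\<And>y. y \<in> E \<Longrightarrow> \<exists>t\<in>R. y = t * D" by blast
  show ?case
  proof (cases "\<exists>t\<in>R. x = t * D")
    case True
    then show ?thesis using D dom by blast
  next
    case False
    have "\<exists>s\<in>R. D = s * x"
    proof (cases "D = 0")
      case True
      then show ?thesis using zero_in by auto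
    next
      case nz: False
      have "x \<noteq> 0" using False zero_in by auto
      have "x / D \<notin> R" using False nz by auto
      then have "inverse (x / D) \<in> R" using total by blast
      then show ?thesis using \<open>x \<noteq> 0\<close> by (intro bexI[of _ "inverse (x / D)"]) auto
    qed
    then obtain s where s: "s \<in> R" "D = s * x" by blast
    have "\<exists>t\<in>R. y = t * x" if y: "y \<in> insert x E" for y
    proof (cases "y = x")
      case True
      then show ?thesis using one_in by auto
    next
      case False
      with y have "y \<in> E" by simp
      from dom[OF this] obtain t where t: "t \<in> R" "y = t * D" by blast
      then have "y = (t * s) * x" using s(2) by simp
      then show ?thesis using mult_in[OF t(1) s(1)] by blast
    qed
    then show ?thesis by blast
  qed
qed

lemma ex_pivot:
  assumes "finite I" "finite N" and nz: "\<exists>i\<in>I. \<exists>j\<in>N. b i j \<noteq> 0"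
  shows "\<exists>i0 p t. i0 \<in> I \<and> p \<in> N \<and> b i0 p \<noteq> 0 \<and> t i0 p = 1 \<and>
    (\<forall>i\<in>I. \<forall>j\<in>N. t i j \<in> R \<and> b i j = t i j * b i0 p)"
proof -
  define E where "E = (\<lambda>(i, j). b i j) ` (I \<times> N)"
  have "finite E" "E \<noteq> {}" using assms by (auto simp: E_def)
  from ex_dominant[OF this] obtain i0 p where i0: "i0 \<in> I" "p \<in> N"
    and dom: "\<And>x. x \<in> E \<Longrightarrow> \<exists>t\<in>R. x = t * b i0 p"
    unfolding E_def by force
  have "b i j \<in> E" if "i \<in> I" "j \<in> N" for i j
    using that by (auto simp: E_def)
  then have "\<forall>i j. \<exists>t. i \<in> I \<longrightarrow> j \<in> N \<longrightarrow> t \<in> R \<and> b i j = t * b i0 p" using dom by blast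
  then obtain t where t: "\<And>i j. i \<in> I \<Longrightarrow> j \<in> N \<Longrightarrow> t i j \<in> R \<and> b i j = t i j * b i0 p"
    by metis
  have "b i0 p \<noteq> 0" using nz t by fastforce
  moreover from this have "t i0 p = 1" using t[OF i0] by simp
  ultimately show ?thesis using i0 t by blast
qed

text \<open>Coefficients \<open>y\<close> and quotient \<open>w\<close> are recorded together, since
  the reductions of both are needed: the former are vectors in the target of the linear map, the
  latter linear forms on its source. For \<open>c = 0\<close> the quotient is any vector over
  \<open>R\<close>.\<close>

definition row_comb :: "'i set \<Rightarrow> 'j set \<Rightarrow> ('i \<Rightarrow> 'j \<Rightarrow> 'l) \<Rightarrow> 'l \<Rightarrow> ('i \<Rightarrow> 'l) \<Rightarrow> ('j \<Rightarrow> 'l) \<Rightarrow> bool" where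
  "row_comb I N b c y w \<longleftrightarrow>
     (\<forall>i\<in>I. y i \<in> R) \<and> (\<forall>j\<in>N. w j \<in> R \<and> (\<Sum>i\<in>I. y i * b i j) = c * w j)"

lemma row_comb_add:
  "row_comb I N b c y w \<Longrightarrow> row_comb I N b c y' w' \<Longrightarrow>
   row_comb I N b c (\<lambda>i. y i + y' i) (\<lambda>j. w j + w' j)"
  by (simp add: row_comb_def add_in distrib_left distrib_right sum.distrib)

lemma row_comb_scale:
  "row_comb I N b c y w \<Longrightarrow> a \<in> R \<Longrightarrow> row_comb I N b c (\<lambda>i. a * y i) (\<lambda>j. a * w j)"
  by (simp add: row_comb_def mult_in mult.assoc sum_distrib_left[symmetric] mult.left_commute)

text \<open>Gaussian elimination, always pivoting on an entry that divides all others. In terms of the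
  Smith normal form of \<open>b\<close>, with each diagonal entry dividing the next, \<open>c\<close> is the diagonal entry
  number \<open>q\<close>, counted from 0.\<close>

lemma elimination:
  fixes b :: "'i \<Rightarrow> 'j \<Rightarrow> 'l"
  assumes "finite I" "finite N" "q < card I"
  shows "\<exists>c A. A \<subseteq> I \<and> card I \<le> card A + q \<and>
     (\<forall>y0. (\<forall>i\<in>A. y0 i \<in> R) \<longrightarrow> (\<exists>y w. row_comb I N b c y w \<and> (\<forall>i\<in>A. y i = y0 i))) \<and>
     (c \<noteq> 0 \<longrightarrow> (\<exists>P\<subseteq>N. card P = Suc q \<and>
        (\<forall>z. \<exists>y w. row_comb I N b c y w \<and> (\<forall>j\<in>P. res (w j) = z j))))"
  using assms
proof (induction q arbitrary: I b)
  case (0 I b)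
  then have "I \<noteq> {}" by auto
  show ?case
  proof (cases "\<forall>i\<in>I. \<forall>j\<in>N. b i j = 0")
    \<comment> \<open>For the zero matrix, \<open>c = 0\<close> makes all combinations divisible and
      the clause on pivots void.\<close>
    case True
    then have "row_comb I N b 0 y0 (\<lambda>_. 0)" if "\<forall>i\<in>I. y0 i \<in> R" for y0
      using that by (simp add: row_comb_def zero_in)
    then show ?thesis by (intro exI[of _ 0] exI[of _ I]) auto
  next
    case False
    then have "\<exists>i\<in>I. \<exists>j\<in>N. b i j \<noteq> 0" by blast
    from ex_pivot[OF 0(1,2) this] obtain i0 p t where i0: "i0 \<in> I" "p \<in> N"
      and D: "b i0 p \<noteq> 0" and t1: "t i0 p = 1"
      and t: "\<And>i j. i \<in> I \<Longrightarrow> j \<in> N \<Longrightarrow> t i j \<in> R"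
        "\<And>i j. i \<in> I \<Longrightarrow> j \<in> N \<Longrightarrow> b i j = t i j * b i0 p" by blast
    have comb: "row_comb I N b (b i0 p) y (\<lambda>j. \<Sum>i\<in>I. y i * t i j)" if "\<forall>i\<in>I. y i \<in> R" for y
      unfolding row_comb_def
    proof (intro conjI ballI)
      fix j assume j: "j \<in> N"
      show "(\<Sum>i\<in>I. y i * t i j) \<in> R" using that t(1) j by (intro sum_in mult_in) auto
      have "(\<Sum>i\<in>I. y i * b i j) = (\<Sum>i\<in>I. b i0 p * (y i * t i j))"
        using t(2) j by (intro sum.cong) auto
      then show "(\<Sum>i\<in>I. y i * b i j) = b i0 p * (\<Sum>i\<in>I. y i * t i j)"
        by (simp add: sum_distrib_left)
    qed (use that in auto)
    have "\<exists>y w. row_comb I N b (b i0 p) y w \<and> (\<forall>j\<in>{p}. res (w j) = z j)" for z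
    proof -
      let ?y = "\<lambda>i. if i = i0 then emb (z p) else 0"
      have "(\<Sum>i\<in>I. ?y i * t i p) = (\<Sum>i\<in>I. if i = i0 then emb (z p) else 0)"
        by (rule sum.cong) (auto simp: t1)
      then have "res (\<Sum>i\<in>I. ?y i * t i p) = z p" using 0 i0 by (simp add: res_emb)
      moreover have "\<forall>i\<in>I. ?y i \<in> R" by (simp add: emb_in zero_in)
      ultimately show ?thesis using comb[of ?y] by blast
    qed
    then show ?thesis
      using comb i0 by (intro exI[of _ "b i0 p"] exI[of _ I]) (auto intro!: exI[of _ "{p}"])
  qed
next
  case (Suc q I b)
  show ?case
  proof (cases "\<forall>i\<in>I. \<forall>j\<in>N. b i j = 0")
    case True
    then have "row_comb I N b 0 y0 (\<lambda>_. 0)" if "\<forall>i\<in>I. y0 i \<in> R" for y0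
      using that by (simp add: row_comb_def zero_in)
    then show ?thesis by (intro exI[of _ 0] exI[of _ I]) auto
  next
    case False
    then have "\<exists>i\<in>I. \<exists>j\<in>N. b i j \<noteq> 0" by blast
    from ex_pivot[OF Suc.prems(1,2) this] obtain i0 p t where i0: "i0 \<in> I" "p \<in> N"
      and D0: "b i0 p \<noteq> 0" and t1: "t i0 p = 1"
      and t: "\<And>i j. i \<in> I \<Longrightarrow> j \<in> N \<Longrightarrow> t i j \<in> R"
        "\<And>i j. i \<in> I \<Longrightarrow> j \<in> N \<Longrightarrow> b i j = t i j * b i0 p" by blast
    define D where "D = b i0 p"
    have D: "D \<noteq> 0" using D0 by (simp add: D_def)
    define I' where "I' = I - {i0}"
    \<comment> \<open>This is the Schur complement of the pivot: column \<open>p\<close> is cleared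
      by means of row \<open>i0\<close>, which is then dropped.\<close>
    define b' where "b' = (\<lambda>i j. b i j - t i p * b i0 j)"
    have I': "finite I'" "q < card I'" "card I = Suc (card I')"
      using Suc.prems i0(1) by (auto simp: I'_def card_Suc_Diff1)
    have sum_I: "(\<Sum>i\<in>I. f i) = f i0 + (\<Sum>i\<in>I'. f i)" for f :: "'i \<Rightarrow> 'l"
      unfolding I'_def using Suc.prems(1) i0(1) by (rule sum.remove)
    have b'_p: "b' i p = 0" if "i \<in> I'" for i
      using t(2)[of i p] that i0(2) by (auto simp: b'_def I'_def)
    have lift: "\<exists>y'. row_comb I N b c y' w \<and> (\<forall>i\<in>I'. y' i = y i)"
      if "row_comb I' N b' c y w" for c y w
    proof -
      \<comment> \<open>This coefficient of the pivot row accounts for the row operations, so a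
        combination of the rows of \<open>b'\<close> becomes one of the rows of \<open>b\<close>
        with the same quotient.\<close>
      let ?s = "- (\<Sum>i\<in>I'. y i * t i p)"
      have "?s \<in> R"
        using that t(1) i0(2)
        by (intro uminus_in sum_in mult_in) (auto simp: row_comb_def I'_def)
      moreover have "(\<Sum>i\<in>I. (y(i0 := ?s)) i * b i j) = (\<Sum>i\<in>I'. y i * b' i j)" for j
      proof -
        have "(\<Sum>i\<in>I'. (y(i0 := ?s)) i * b i j) = (\<Sum>i\<in>I'. y i * b i j)"
          by (rule sum.cong) (auto simp: I'_def)
        then show ?thesis
          unfolding sum_I
          by (simp add: b'_def sum_subtractf sum_distrib_right right_diff_distrib mult.assoc)
      qed
      ultimately show ?thesis
        using that by (intro exI[of _ "y(i0 := ?s)"]) (auto simp: row_comb_def I'_def)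
    qed
    \<comment> \<open>The set \<open>A\<close> is kept: the dropped row \<open>i0\<close> is the one
      additional unit of codimension allowed for \<open>Suc q\<close>.\<close>
    from Suc.IH[OF I'(1) Suc.prems(2) I'(2), of b'] obtain c A where
      A: "A \<subseteq> I'" "card I' \<le> card A + q"
      and free: "\<And>y0. \<forall>i\<in>A. y0 i \<in> R \<Longrightarrow> \<exists>y w. row_comb I' N b' c y w \<and> (\<forall>i\<in>A. y i = y0 i)"
      and piv: "c \<noteq> 0 \<Longrightarrow> \<exists>P\<subseteq>N. card P = Suc q \<and>
        (\<forall>z. \<exists>y w. row_comb I' N b' c y w \<and> (\<forall>j\<in>P. res (w j) = z j))" by blast
    have "\<exists>y w. row_comb I N b c y w \<and> (\<forall>i\<in>A. y i = y0 i)" if "\<forall>i\<in>A. y0 i \<in> R" for y0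
    proof -
      from free[OF that] obtain y w where y: "row_comb I' N b' c y w" "\<forall>i\<in>A. y i = y0 i" by blast
      from lift[OF y(1)] obtain y' where "row_comb I N b c y' w" "\<forall>i\<in>I'. y' i = y i" by blast
      with y(2) A(1) show ?thesis by (intro exI[of _ y'] exI[of _ w]) auto
    qed
    moreover have "\<exists>P\<subseteq>N. card P = Suc (Suc q) \<and>
        (\<forall>z. \<exists>y w. row_comb I N b c y w \<and> (\<forall>j\<in>P. res (w j) = z j))" if c: "c \<noteq> 0"
    proof -
      from piv[OF c] obtain P where P: "P \<subseteq> N" "card P = Suc q"
        and hit: "\<And>z. \<exists>y w. row_comb I' N b' c y w \<and> (\<forall>j\<in>P. res (w j) = z j)" by blast
      have w_p: "w p = 0" if "row_comb I' N b' c y w" for y w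
      proof -
        have "c * w p = (\<Sum>i\<in>I'. y i * b' i p)" using that i0(2) by (simp add: row_comb_def)
        also have "\<dots> = 0" by (simp add: b'_p)
        finally show ?thesis using c by simp
      qed
      \<comment> \<open>A sample combination with residues 1 on \<open>P\<close>. It shows that
        \<open>p\<close> is a new position, because quotients for \<open>b'\<close> vanish at
        \<open>p\<close>, and, through its entry at \<open>j1\<close>, that the old pivot divides
        \<open>c\<close>.\<close>
      from hit[of "\<lambda>_. 1"] obtain y1 w1 where
        w1: "row_comb I' N b' c y1 w1" "\<And>j. j \<in> P \<Longrightarrow> res (w1 j) = 1" by blast
      have "p \<notin> P" using w1(2)[of p] w_p[OF w1(1)] by (auto simp: res_0)
      obtain j1 where j1: "j1 \<in> P" using P(2) by fastforce
      then have j1N: "j1 \<in> N" using P(1) by auto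
      have w1_in: "w1 j1 \<in> R" using w1(1) j1N by (simp add: row_comb_def)
      have w1_0: "w1 j1 \<noteq> 0" using w1(2)[OF j1] res_0 by auto
      have w1_inv: "inverse (w1 j1) \<in> R" using inverse_in[OF w1_in] w1(2)[OF j1] by simp
      \<comment> \<open>\<open>s\<close> is the quotient of \<open>c\<close> by the pivot
        \<open>D\<close>. It lies in \<open>R\<close> because all entries of \<open>b'\<close> are
        multiples of \<open>D\<close> and \<open>w1 j1\<close> is a unit.\<close>
      define s where "s = (\<Sum>i\<in>I'. y1 i * (t i j1 - t i p * t i0 j1)) * inverse (w1 j1)"
      have s: "s \<in> R"
        unfolding s_def using w1(1) w1_inv t(1) j1N i0
        by (intro mult_in sum_in diff_in) (auto simp: row_comb_def I'_def)
      have "c * w1 j1 = (\<Sum>i\<in>I'. y1 i * b' i j1)" using w1(1) j1N by (simp add: row_comb_def)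
      also have "\<dots> = (\<Sum>i\<in>I'. D * (y1 i * (t i j1 - t i p * t i0 j1)))"
      proof (rule sum.cong[OF refl])
        fix i assume "i \<in> I'"
        then have "b' i j1 = D * (t i j1 - t i p * t i0 j1)"
          using t(2)[OF i0(1) j1N] t(2)[of i j1] j1N
          by (simp add: b'_def I'_def D_def algebra_simps)
        then show "y1 i * b' i j1 = D * (y1 i * (t i j1 - t i p * t i0 j1))" by simp
      qed
      also have "\<dots> = D * (\<Sum>i\<in>I'. y1 i * (t i j1 - t i p * t i0 j1))"
        by (rule sum_distrib_left[symmetric])
      also have "(\<Sum>i\<in>I'. y1 i * (t i j1 - t i p * t i0 j1)) = s * w1 j1"
        using w1_0 by (simp add: s_def)
      finally have "c * w1 j1 = D * (s * w1 j1)" .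
      then have c_eq: "c = D * s" using w1_0 by simp
      have "\<exists>y w. row_comb I N b c y w \<and> (\<forall>j\<in>insert p P. res (w j) = z j)" for z
      proof -
        \<comment> \<open>\<open>s\<close> times the pivot row is \<open>c\<close> times
          \<open>t i0\<close>, which is 1 at \<open>p\<close>. Adding \<open>z p\<close> times this
          row produces the value at \<open>p\<close>; \<open>z'\<close> subtracts in advance what it
          contributes on \<open>P\<close>.\<close>
        define z' where "z' = (\<lambda>j. z j - z p * res (t i0 j))"
        from hit[of z'] obtain y w where
          yw: "row_comb I' N b' c y w" "\<And>j. j \<in> P \<Longrightarrow> res (w j) = z' j" by blast
        from lift[OF yw(1)] obtain y' where y': "row_comb I N b c y' w" by blast
        let ?y = "\<lambda>i. emb (z p) * (if i = i0 then s else 0)" and ?w = "\<lambda>j. emb (z p) * t i0 j"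
        have "row_comb I N b c (\<lambda>i. if i = i0 then s else 0) (t i0)"
          unfolding row_comb_def
        proof (intro conjI ballI)
          fix j assume j: "j \<in> N"
          have "(\<Sum>i\<in>I. (if i = i0 then s else 0) * b i j) = (\<Sum>i\<in>I. if i = i0 then s * b i0 j else 0)"
            by (rule sum.cong) auto
          also have "\<dots> = c * t i0 j"
            using Suc.prems(1) i0 t(2)[OF i0(1) j] by (simp add: c_eq D_def)
          finally show "(\<Sum>i\<in>I. (if i = i0 then s else 0) * b i j) = c * t i0 j" .
        qed (use s t(1) i0 zero_in in auto)
        from row_comb_add[OF row_comb_scale[OF this emb_in[of "z p"]] y']
        have "row_comb I N b c (\<lambda>i. ?y i + y' i) (\<lambda>j. ?w j + w j)" .
        moreover have "res (?w j + w j) = z j" if j: "j \<in> insert p P" for j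
        proof -
          have jN: "j \<in> N" using j P(1) i0(2) by auto
          have "res (?w j + w j) = z p * res (t i0 j) + res (w j)"
            using yw(1) t(1)[OF i0(1) jN] jN
            by (simp add: res_add res_mult res_emb emb_in mult_in row_comb_def)
          also have "\<dots> = z j"
          proof (cases "j = p")
            case True
            then show ?thesis using w_p[OF yw(1)] by (simp add: t1 res_1 res_0)
          next
            case False
            then show ?thesis using j yw(2)[of j] by (simp add: z'_def)
          qed
          finally show ?thesis .
        qed
        ultimately show ?thesis by blast
      qed
      moreover have "card (insert p P) = Suc (Suc q)"
        using P \<open>p \<notin> P\<close> Suc.prems(2) by (simp add: finite_subset)
      ultimately show ?thesis using P(1) i0(2) by (intro exI[of _ "insert p P"]) auto
    qed
    ultimately show ?thesis
      using A I'(3) by (intro exI[of _ c] exI[of _ A]) (auto simp: I'_def)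
  qed
qed

end

section \<open>Slice rank of the unit tensor\<close>

text \<open>As in an echelon form, a subspace has at least as many leading positions with respect to
  \<open>\<rho>\<close> as its dimension. With fewer, some nontrivial combination of the vectors
  dual to \<open>A\<close> would vanish at all of them, including its own leading position.\<close>

lemma card_leading_positions:
  fixes V :: "('i \<Rightarrow> 'a::field) set" and \<rho> :: "'i \<Rightarrow> nat"
  assumes I: "finite I" "A \<subseteq> I"
    and add: "\<And>y y'. y \<in> V \<Longrightarrow> y' \<in> V \<Longrightarrow> (\<lambda>i. y i + y' i) \<in> V"
    and scale: "\<And>y c. y \<in> V \<Longrightarrow> (\<lambda>i. c * y i) \<in> V"
    and surj: "\<And>z. \<exists>y\<in>V. \<forall>i\<in>A. y i = z i"
  shows "card A \<le> card {l \<in> I. \<exists>y\<in>V. y l \<noteq> 0 \<and> (\<forall>i\<in>I. \<rho> i < \<rho> l \<longrightarrow> y i = 0)}"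
    (is "_ \<le> card ?L")
proof (rule ccontr)
  assume "\<not> ?thesis"
  then have less: "card ?L < card A" by simp
  have finA: "finite A" using I by (rule finite_subset[rotated])
  have "\<forall>a. \<exists>y. y \<in> V \<and> (\<forall>i\<in>A. y i = (if i = a then 1 else 0))"
  proof
    fix a show "\<exists>y. y \<in> V \<and> (\<forall>i\<in>A. y i = (if i = a then 1 else 0))"
      using surj[of "\<lambda>i. if i = a then 1 else 0"] by blast
  qed
  then obtain e where e: "\<And>a. e a \<in> V" "\<And>a i. i \<in> A \<Longrightarrow> e a i = (if i = a then 1 else 0)"
    by metis
  have "\<exists>c. (\<exists>a\<in>A. c a \<noteq> 0) \<and> (\<forall>l\<in>?L. (\<Sum>a\<in>A. e a l * c a) = 0)"
    using I(1) finA less by (intro homogeneous_linear_system) auto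
  then obtain c a0 where c: "a0 \<in> A" "c a0 \<noteq> 0" "\<And>l. l \<in> ?L \<Longrightarrow> (\<Sum>a\<in>A. e a l * c a) = 0"
    by blast
  define y where "y = (\<lambda>i. \<Sum>a\<in>A. e a i * c a)"
  have zero: "(\<lambda>i. 0) \<in> V" using scale[OF e(1), of 0] by simp
  have "(\<lambda>i. \<Sum>a\<in>B. e a i * c a) \<in> V" if "finite B" for B
    using that
  proof induction
    case (insert a B)
    then show ?case using add[OF scale[OF e(1)[of a], of "c a"] insert.IH] by (simp add: mult.commute)
  qed (use zero in simp)
  then have yV: "y \<in> V" using finA by (simp add: y_def)
  have "y a0 = (\<Sum>a\<in>A. if a = a0 then c a else 0)"
    unfolding y_def using c(1) by (intro sum.cong) (auto simp: e(2))
  then have y0: "y a0 \<noteq> 0" using c(1,2) finA by simp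
  obtain l where l: "l \<in> I" "y l \<noteq> 0" and min: "\<And>i. i \<in> I \<Longrightarrow> y i \<noteq> 0 \<Longrightarrow> \<rho> l \<le> \<rho> i"
    using ex_has_least_nat[of "\<lambda>i. i \<in> I \<and> y i \<noteq> 0" a0 \<rho>] c(1) y0 I(2) by blast
  have "l \<in> ?L" using l min yV by (force intro: bexI[of _ y])
  from c(3)[OF this] l(2) show False by (simp add: y_def)
qed

text \<open>This is the fact that the unit tensor has slice rank \<open>r\<close>. The vectors are chosen with a common
  nonzero coordinate \<open>j\<^sub>0\<close> such that the first one vanishes before \<open>j\<^sub>0\<close> and the second one after it.\<close>

lemma unit_tensor_nonzero_on_product:
  fixes V :: "nat \<Rightarrow> (nat \<Rightarrow> 'a::field) set"
  assumes d: "d \<ge> 2" and q: "d * q < r"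
    and A: "\<And>k. k < d \<Longrightarrow> A k \<subseteq> {..<r}" "\<And>k. k < d \<Longrightarrow> r \<le> card (A k) + q"
    and add: "\<And>k y y'. k < d \<Longrightarrow> y \<in> V k \<Longrightarrow> y' \<in> V k \<Longrightarrow> (\<lambda>i. y i + y' i) \<in> V k"
    and scale: "\<And>k y c. k < d \<Longrightarrow> y \<in> V k \<Longrightarrow> (\<lambda>i. c * y i) \<in> V k"
    and surj: "\<And>k z. k < d \<Longrightarrow> \<exists>y\<in>V k. \<forall>i\<in>A k. y i = z i"
  shows "\<exists>y. (\<forall>k<d. y k \<in> V k) \<and> (\<Sum>j<r. \<Prod>k<d. y k j) \<noteq> 0"
proof -
  \<comment> \<open>For \<open>k = 1\<close> the order is reversed: leading positions of that factor
    are last nonzero coordinates, those of all other factors are first ones.\<close>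
  define \<rho> where "\<rho> = (\<lambda>k i. if k = (1::nat) then r - i else i)"
  define L where "L = (\<lambda>k. {l \<in> {..<r}. \<exists>y\<in>V k. y l \<noteq> 0 \<and> (\<forall>i\<in>{..<r}. \<rho> k i < \<rho> k l \<longrightarrow> y i = 0)})"
  have L: "card ({..<r} - L k) \<le> q" if k: "k < d" for k
  proof -
    have "card (A k) \<le> card (L k)"
      unfolding L_def using A(1)[OF k] add[OF k] scale[OF k] surj[OF k]
      by (intro card_leading_positions) auto
    moreover have "L k \<subseteq> {..<r}" by (auto simp: L_def)
    ultimately show ?thesis using A(2)[OF k] by (simp add: card_Diff_subset finite_subset)
  qed
  \<comment> \<open>Each factor rules out at most \<open>q\<close> positions and
    \<open>d * q < r\<close>, so some position \<open>j0\<close> is leading for all factors.\<close>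
  have "card (\<Union>k<d. {..<r} - L k) \<le> (\<Sum>k<d. card ({..<r} - L k))" by (rule card_UN_le) simp
  also have "\<dots> \<le> (\<Sum>k<d. q)" using L by (intro sum_mono) auto
  also have "\<dots> < card {..<r}" using q by simp
  finally have "\<not> {..<r} \<subseteq> (\<Union>k<d. {..<r} - L k)" by (metis card_mono finite_UN finite_Diff finite_lessThan leD)
  then obtain j0 where j0: "j0 < r" "\<And>k. k < d \<Longrightarrow> j0 \<in> L k" by auto
  then have "\<forall>k. \<exists>y. k < d \<longrightarrow> y \<in> V k \<and> y j0 \<noteq> 0 \<and> (\<forall>i\<in>{..<r}. \<rho> k i < \<rho> k j0 \<longrightarrow> y i = 0)"
    unfolding L_def by blast
  then obtain y where y: "\<And>k. k < d \<Longrightarrow> y k \<in> V k" "\<And>k. k < d \<Longrightarrow> y k j0 \<noteq> 0"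
    "\<And>k i. k < d \<Longrightarrow> i < r \<Longrightarrow> \<rho> k i < \<rho> k j0 \<Longrightarrow> y k i = 0" by (metis lessThan_iff)
  have "(\<Prod>k<d. y k j) = 0" if j: "j < r" "j \<noteq> j0" for j
  proof -
    have "\<exists>k<d. y k j = 0"
    proof (cases "j < j0")
      case True
      then have "y 0 j = 0" using d j by (intro y(3)) (auto simp: \<rho>_def)
      then show ?thesis using d by (intro exI[of _ 0]) simp
    next
      case False
      then have "y 1 j = 0" using d j j0(1) by (intro y(3)) (auto simp: \<rho>_def)
      then show ?thesis using d by (intro exI[of _ 1]) simp
    qed
    then show ?thesis by auto
  qed
  then have "(\<Sum>j<r. \<Prod>k<d. y k j) = (\<Sum>j\<in>{j0}. \<Prod>k<d. y k j)"
    using j0(1) by (intro sum.mono_neutral_right) auto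
  also have "\<dots> \<noteq> 0" using y(2) by simp
  finally show ?thesis using y(1) by blast
qed

section \<open>Sums over multi-indices\<close>

lemma multi_indices_Cons:
  "multi_indices (n # ns) = (\<lambda>(j, js). j # js) ` ({..<n} \<times> multi_indices ns)"
  by (auto simp: multi_indices_def list_all2_Cons2 image_iff)

lemma sum_multi_indices_prod:
  fixes g :: "nat \<Rightarrow> nat \<Rightarrow> 'a::comm_semiring_1"
  shows "(\<Sum>js\<in>multi_indices (replicate d r). \<Prod>k<d. g k (js ! k)) = (\<Prod>k<d. \<Sum>i<r. g k i)"
proof (induction d arbitrary: g)
  case 0
  then show ?case by (simp add: multi_indices_def)
next
  case (Suc d)
  have "(\<Sum>js\<in>multi_indices (replicate (Suc d) r). \<Prod>k<Suc d. g k (js ! k)) =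
      (\<Sum>(i, js)\<in>{..<r} \<times> multi_indices (replicate d r). \<Prod>k<Suc d. g k ((i # js) ! k))"
    unfolding replicate_Suc multi_indices_Cons
    by (subst sum.reindex) (auto simp: inj_on_def case_prod_unfold)
  also have "\<dots> = (\<Sum>i<r. \<Sum>js\<in>multi_indices (replicate d r). g 0 i * (\<Prod>k<d. g (Suc k) (js ! k)))"
    by (simp add: sum.cartesian_product prod.lessThan_Suc_shift del: prod.lessThan_Suc)
  also have "\<dots> = (\<Prod>k<Suc d. \<Sum>i<r. g k i)"
    by (simp add: prod.lessThan_Suc_shift sum_distrib_left[symmetric] sum_distrib_right[symmetric]
        Suc.IH[of "\<lambda>k. g (Suc k)"] del: prod.lessThan_Suc)
  finally show ?case .
qed

lemma sum_unit_tensor: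
  fixes g :: "nat list \<Rightarrow> 'a::field"
  assumes "d > 0"
  shows "(\<Sum>is\<in>multi_indices (replicate d r). g is * unit_tensor d r is) = (\<Sum>j<r. g (replicate d j))"
proof -
  have "(\<Sum>is\<in>multi_indices (replicate d r). g is * unit_tensor d r is) =
      (\<Sum>is\<in>multi_indices (replicate d r). \<Sum>j<r. if is = replicate d j then g is else 0)"
    unfolding unit_tensor_def sum_distrib_left by (intro sum.cong) auto
  also have "\<dots> = (\<Sum>j<r. \<Sum>is\<in>multi_indices (replicate d r). if is = replicate d j then g is else 0)"
    by (rule sum.swap)
  also have "\<dots> = (\<Sum>j<r. g (replicate d j))"
  proof (rule sum.cong[OF refl])
    fix j assume "j \<in> {..<r}"
    then have "replicate d j \<in> multi_indices (replicate d r)" by (simp add: multi_indices_replicate)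
    then show "(\<Sum>is\<in>multi_indices (replicate d r). if is = replicate d j then g is else 0) =
        g (replicate d j)" by (simp add: finite_multi_indices)
  qed
  finally show ?thesis .
qed

section \<open>Specialising generic matrices\<close>

text \<open>A type is required for the field of fractions. The ring has no zero divisors because
  affine space is irreducible, which rests on an algebraically closed field being infinite.\<close>

typedef (overloaded) ('i, 'a) pfun = "poly_fun UNIV :: (('i \<Rightarrow> 'a::alg_closed_field) \<Rightarrow> 'a) set"
  by (intro exI[of _ "\<lambda>_. 0"] poly_fun.const)

setup_lifting type_definition_pfun

instantiation pfun :: (type, alg_closed_field) idom
begin

lift_definition zero_pfun :: "('a, 'b) pfun" is "\<lambda>_. 0" by (rule poly_fun.const)
lift_definition one_pfun :: "('a, 'b) pfun" is "\<lambda>_. 1" by (rule poly_fun.const)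
lift_definition plus_pfun :: "('a, 'b) pfun \<Rightarrow> ('a, 'b) pfun \<Rightarrow> ('a, 'b) pfun"
  is "\<lambda>f g x. f x + g x" by (rule poly_fun.add)
lift_definition times_pfun :: "('a, 'b) pfun \<Rightarrow> ('a, 'b) pfun \<Rightarrow> ('a, 'b) pfun"
  is "\<lambda>f g x. f x * g x" by (rule poly_fun.mult)
lift_definition uminus_pfun :: "('a, 'b) pfun \<Rightarrow> ('a, 'b) pfun" is "\<lambda>f x. - f x"
  using poly_fun.mult[OF poly_fun.const[of "-1"]] by fastforce
lift_definition minus_pfun :: "('a, 'b) pfun \<Rightarrow> ('a, 'b) pfun \<Rightarrow> ('a, 'b) pfun"
  is "\<lambda>f g x. f x - g x"
proof -
  fix f g :: "('a \<Rightarrow> 'b) \<Rightarrow> 'b"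
  assume "f \<in> poly_fun UNIV" "g \<in> poly_fun UNIV"
  then have "(\<lambda>x. f x + (- 1) * g x) \<in> poly_fun UNIV"
    by (intro poly_fun.add poly_fun.mult poly_fun.const)
  then show "(\<lambda>x. f x - g x) \<in> poly_fun UNIV" by simp
qed

instance
proof
  fix a b c :: "('a, 'b) pfun"
  show "a + b + c = a + (b + c)" "a + b = b + a" "0 + a = a" "- a + a = 0" "a - b = a + - b"
    "a * b * c = a * (b * c)" "a * b = b * a" "1 * a = a" "(a + b) * c = a * c + b * c"
    "a * (b + c) = a * b + a * c" "0 * a = 0" "a * 0 = 0"
    by (transfer; simp add: fun_eq_iff algebra_simps)+
  show "(0 :: ('a, 'b) pfun) \<noteq> 1" by transfer (simp add: fun_eq_iff)
  assume "a \<noteq> 0" "b \<noteq> 0"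
  then show "a * b \<noteq> 0"
  proof transfer
    fix f g :: "('a \<Rightarrow> 'b) \<Rightarrow> 'b"
    assume "f \<in> poly_fun UNIV" "g \<in> poly_fun UNIV" "f \<noteq> (\<lambda>_. 0)" "g \<noteq> (\<lambda>_. 0)"
    then obtain x y where "f x \<noteq> 0" "g y \<noteq> 0" by (auto simp: fun_eq_iff)
    with coord_space_irreducible[of f UNIV g x y] \<open>f \<in> _\<close> \<open>g \<in> _\<close>
    show "(\<lambda>x. f x * g x) \<noteq> (\<lambda>_. 0)" by (auto simp: coord_space_def fun_eq_iff)
  qed
qed

end

lift_definition pfun_const :: "'a::alg_closed_field \<Rightarrow> ('i, 'a) pfun" is "\<lambda>c _. c"
  by (rule poly_fun.const)

lift_definition pfun_var :: "'i \<Rightarrow> ('i, 'a::alg_closed_field) pfun" is "\<lambda>i x. x i"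
  by (rule poly_fun.coord) simp

lemma Rep_pfun_sum: "Rep_pfun (\<Sum>a\<in>A. f a) x = (\<Sum>a\<in>A. Rep_pfun (f a) x)"
  by (induction A rule: infinite_finite_induct) (simp_all add: zero_pfun.rep_eq plus_pfun.rep_eq)

lemma Rep_pfun_prod: "Rep_pfun (\<Prod>a\<in>A. f a) x = (\<Prod>a\<in>A. Rep_pfun (f a) x)"
  by (induction A rule: infinite_finite_induct) (simp_all add: one_pfun.rep_eq times_pfun.rep_eq)

lemma to_fract_prod: "to_fract (\<Prod>a\<in>A. f a) = (\<Prod>a\<in>A. to_fract (f a))"
  by (induction A rule: infinite_finite_induct) simp_all

lemma field_embedding_pfun: "field_embedding (\<lambda>c :: 'a::alg_closed_field. to_fract (pfun_const c :: ('i, 'a) pfun))"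
proof
  fix a b :: 'a
  have "pfun_const 0 = (0 :: ('i, 'a) pfun)" "pfun_const 1 = (1 :: ('i, 'a) pfun)"
    "pfun_const (a + b) = (pfun_const a + pfun_const b :: ('i, 'a) pfun)"
    "pfun_const (a * b) = (pfun_const a * pfun_const b :: ('i, 'a) pfun)"
    by (transfer; simp)+
  then show "to_fract (pfun_const 0 :: ('i, 'a) pfun) = 0" "to_fract (pfun_const 1 :: ('i, 'a) pfun) = 1"
    "to_fract (pfun_const (a + b) :: ('i, 'a) pfun) = to_fract (pfun_const a) + to_fract (pfun_const b)"
    "to_fract (pfun_const (a * b) :: ('i, 'a) pfun) = to_fract (pfun_const a) * to_fract (pfun_const b)"
    by simp_all
qed

text \<open>The entries of the \<open>X k\<close> are independent variables, and the place extends
  the map sending \<open>F\<close>, evaluated at the generic image of \<open>T\<close>, to its value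
  at the unit tensor. This is well defined exactly by membership in the closure: if \<open>F\<close>
  vanishes at the generic image, it vanishes at all images, hence at the unit tensor.\<close>

lemma ex_place_of_closure:
  fixes T :: "nat list \<Rightarrow> 'a::alg_closed_field"
  assumes cl: "unit_tensor d r \<in>
      zariski_closure (multi_indices (replicate d r)) (tensor_images (replicate d n) r T)"
  shows "\<exists>emb :: 'a \<Rightarrow> (nat \<times> nat \<times> nat, 'a) pfun fract. \<exists>R res X. place emb R res \<and>
    (\<forall>is\<in>multi_indices (replicate d r).
      (\<Sum>js\<in>multi_indices (replicate d n). (\<Prod>k<d. X k (is ! k) (js ! k)) * emb (T js)) \<in> R \<and>
      res (\<Sum>js\<in>multi_indices (replicate d n). (\<Prod>k<d. X k (is ! k) (js ! k)) * emb (T js)) =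
        unit_tensor d r is)"
proof -
  let ?Ir = "multi_indices (replicate d r)" and ?In = "multi_indices (replicate d n)"
  define emb where "emb = (\<lambda>c :: 'a. to_fract (pfun_const c :: (nat \<times> nat \<times> nat, 'a) pfun))"
  define X where "X = (\<lambda>k i j. to_fract (pfun_var (k, i, j) :: (nat \<times> nat \<times> nat, 'a) pfun))"
  define img where
    "img = (\<lambda>x. tensor_apply (replicate d n) r (\<lambda>k. mat r n (\<lambda>(i, j). x (k, i, j))) T)"
  interpret field_embedding emb unfolding emb_def by (rule field_embedding_pfun)
  have img_in: "img x \<in> tensor_images (replicate d n) r T" for x
    by (auto simp: img_def tensor_images_def)
  have img_eq: "img x is = (\<Sum>js\<in>?In. (\<Prod>k<d. x (k, is ! k, js ! k)) * T js)" if "is \<in> ?Ir" for x "is"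
  proof -
    have "img x is = (\<Sum>js\<in>?In. (\<Prod>k<d. mat r n (\<lambda>(i, j). x (k, i, j)) $$ (is ! k, js ! k)) * T js)"
      using that by (simp add: img_def tensor_apply_def)
    also have "\<dots> = (\<Sum>js\<in>?In. (\<Prod>k<d. x (k, is ! k, js ! k)) * T js)"
      using that by (intro sum.cong refl arg_cong2[of _ _ _ _ "(*)"] prod.cong)
        (auto simp: multi_indices_replicate)
    finally show ?thesis .
  qed
  have img_poly: "(\<lambda>x. img x is) \<in> poly_fun UNIV" if "is \<in> ?Ir" for "is"
    unfolding img_eq[OF that]
    by (intro poly_fun_sum poly_fun.mult poly_fun_prod poly_fun.const poly_fun.coord) simp
  have comp: "(\<lambda>x. F (img x)) \<in> poly_fun UNIV" if "F \<in> poly_fun ?Ir" for F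
    using that img_poly by (rule poly_fun_compose)
  define \<Phi> where "\<Phi> = (\<lambda>F. to_fract (Abs_pfun (\<lambda>x. F (img x))))"
  define G0 where "G0 = (\<lambda>F. (\<Phi> F, F (unit_tensor d r))) ` poly_fun ?Ir"
  have "subalgebra G0"
    unfolding subalgebra_def
  proof (intro conjI allI impI)
    fix c
    have "(emb c, c) = (\<Phi> (\<lambda>_. c), (\<lambda>_. c) (unit_tensor d r))"
      by (simp add: \<Phi>_def emb_def pfun_const_def)
    then show "(emb c, c) \<in> G0" unfolding G0_def by (intro image_eqI[OF _ poly_fun.const])
  next
    fix x a y b assume "(x, a) \<in> G0" "(y, b) \<in> G0"
    then obtain F F' where F: "F \<in> poly_fun ?Ir" "F' \<in> poly_fun ?Ir" "x = \<Phi> F" "y = \<Phi> F'"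
      "a = F (unit_tensor d r)" "b = F' (unit_tensor d r)" by (auto simp: G0_def)
    note F' = F(1,2)[THEN comp]
    have "\<Phi> (\<lambda>t. F t + F' t) = x + y" "\<Phi> (\<lambda>t. F t * F' t) = x * y"
      using F' by (simp_all add: \<Phi>_def F plus_pfun.abs_eq times_pfun.abs_eq eq_onp_def
          flip: to_fract_add to_fract_mult)
    then have "(x + y, a + b) = (\<Phi> (\<lambda>t. F t + F' t), (\<lambda>t. F t + F' t) (unit_tensor d r))"
      "(x * y, a * b) = (\<Phi> (\<lambda>t. F t * F' t), (\<lambda>t. F t * F' t) (unit_tensor d r))"
      by (simp_all add: F)
    with poly_fun.add[OF F(1,2)] poly_fun.mult[OF F(1,2)]
    show "(x + y, a + b) \<in> G0" "(x * y, a * b) \<in> G0"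
      unfolding G0_def by (blast intro: image_eqI)+
  qed
  moreover have "(0, 1) \<notin> G0"
  proof
    assume "(0, 1) \<in> G0"
    then obtain F where F: "F \<in> poly_fun ?Ir" "\<Phi> F = 0" "F (unit_tensor d r) = 1"
      by (auto simp: G0_def)
    have "Abs_pfun (\<lambda>x. F (img x)) = 0" using F(2) by (simp add: \<Phi>_def)
    then have img0: "F (img x) = 0" for x
      using Abs_pfun_inverse[OF comp[OF F(1)]] by (metis zero_pfun.rep_eq)
    have "F t = 0" if "t \<in> tensor_images (replicate d n) r T" for t
    proof -
      from that obtain \<phi> where t: "t = tensor_apply (replicate d n) r \<phi> T"
        and \<phi>: "\<And>k. k < d \<Longrightarrow> \<phi> k \<in> carrier_mat r n" by (auto simp: tensor_images_def)
      have "t = img (\<lambda>(k, i, j). \<phi> k $$ (i, j))"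
        unfolding t img_def tensor_apply_def
        by (intro ext if_cong sum.cong refl arg_cong2[of _ _ _ _ "(*)"] prod.cong)
          (auto simp: multi_indices_replicate)
      then show ?thesis using img0 by simp
    qed
    then have "F \<in> vanishing_ideal ?Ir (tensor_images (replicate d n) r T)"
      using F(1) by (simp add: vanishing_ideal_def)
    then show False using cl F(3) by (auto simp: zariski_closure_def zero_locus_def)
  qed
  ultimately have "\<exists>R res. place emb R res \<and> (\<forall>(x, a)\<in>G0. x \<in> R \<and> res x = a)"
    by (rule place_extension[OF field_embedding_axioms])
  then obtain R res where place: "place emb R res"
    and G0': "\<forall>(x, a)\<in>G0. x \<in> R \<and> res x = a" by (elim exE conjE)
  have G0: "x \<in> R \<and> res x = a" if "(x, a) \<in> G0" for x a
    using bspec[OF G0' that] by simp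
  have "(\<Sum>js\<in>?In. (\<Prod>k<d. X k (is ! k) (js ! k)) * emb (T js)) = \<Phi> (\<lambda>t. t is)"
    if "is \<in> ?Ir" for "is"
  proof -
    let ?s = "\<Sum>js\<in>?In. (\<Prod>k<d. pfun_var (k, is ! k, js ! k)) * pfun_const (T js)"
    have rep: "Rep_pfun ?s = (\<lambda>x. img x is)"
      using that by (simp add: fun_eq_iff Rep_pfun_sum Rep_pfun_prod times_pfun.rep_eq
          pfun_var.rep_eq pfun_const.rep_eq img_eq)
    have "Abs_pfun (\<lambda>x. img x is) = ?s" unfolding rep[symmetric] by (rule Rep_pfun_inverse)
    then show ?thesis by (simp add: X_def emb_def \<Phi>_def to_fract_prod)
  qed
  moreover have "\<Phi> (\<lambda>t. t is) \<in> R \<and> res (\<Phi> (\<lambda>t. t is)) = unit_tensor d r is"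
    if "is \<in> ?Ir" for "is"
    using that
    by (intro G0, unfold G0_def, intro image_eqI[of _ _ "\<lambda>t. t is"] poly_fun.coord) auto
  ultimately show ?thesis
    using place by (intro exI[of _ emb] exI[of _ R] exI[of _ res] exI[of _ X]) simp
qed

text \<open>After applying linear maps to \<open>T\<close> whose matrices \<open>a k\<close> are the identity in the columns \<open>P k\<close>,
  one obtains a tensor of rank at most \<open>r\<close>, namely the sum of the products of the rows \<open>y k\<close>.\<close>

definition low_rank_block :: "nat \<Rightarrow> nat \<Rightarrow> nat \<Rightarrow> (nat \<Rightarrow> nat set) \<Rightarrow> (nat list \<Rightarrow> 'a::field) \<Rightarrow> bool" where
  "low_rank_block d n r P T \<longleftrightarrow> (\<exists>a y.
     (\<forall>k<d. \<forall>s\<in>P k. \<forall>j\<in>P k. a k s j = (if j = s then 1 else 0)) \<and>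
     (\<forall>ss. length ss = d \<longrightarrow> (\<forall>k<d. ss ! k \<in> P k) \<longrightarrow>
       (\<Sum>js\<in>multi_indices (replicate d n). (\<Prod>k<d. a k (ss ! k) (js ! k)) * T js) =
       (\<Sum>j<r. \<Prod>k<d. y k (ss ! k) j)))"

text \<open>The identity \<open>key\<close> equates the contraction of the generic image
  \<open>W\<close> with the coefficients \<open>y\<close> and \<open>C\<close> times the contraction
  of \<open>T\<close> with the quotients \<open>w\<close>. The former reduces to the unit tensor at
  the reductions of \<open>y\<close>. The identity is used twice: to see that
  \<open>inverse C\<close> lies in \<open>R\<close>, and then, divided by \<open>C\<close>, to write
  a restriction of \<open>T\<close> as a sum of \<open>r\<close> products.\<close>

lemma low_rank_block_of_closure:
  fixes T :: "nat list \<Rightarrow> 'a::alg_closed_field"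
  assumes d: "d \<ge> 2" and q: "d * q < r"
    and cl: "unit_tensor d r \<in>
      zariski_closure (multi_indices (replicate d r)) (tensor_images (replicate d n) r T)"
  shows "\<exists>P. (\<forall>k<d. P k \<subseteq> {..<n} \<and> card (P k) = Suc q) \<and> low_rank_block d n r P T"
proof -
  let ?Ir = "multi_indices (replicate d r)" and ?In = "multi_indices (replicate d n)"
  obtain emb :: "'a \<Rightarrow> (nat \<times> nat \<times> nat, 'a) pfun fract" and R res X where pl: "place emb R res"
    and W': "\<forall>is\<in>?Ir. (\<Sum>js\<in>?In. (\<Prod>k<d. X k (is ! k) (js ! k)) * emb (T js)) \<in> R \<and>
      res (\<Sum>js\<in>?In. (\<Prod>k<d. X k (is ! k) (js ! k)) * emb (T js)) = unit_tensor d r is"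
    using ex_place_of_closure[OF cl] by (elim exE conjE)
  interpret place emb R res by (rule pl)
  define W where "W = (\<lambda>is. \<Sum>js\<in>?In. (\<Prod>k<d. X k (is ! k) (js ! k)) * emb (T js))"
  have W: "W is \<in> R" "res (W is) = unit_tensor d r is" if "is \<in> ?Ir" for "is"
    using bspec[OF W' that] by (simp_all add: W_def)
  have d0: "d > 0" using d by simp
  have "q \<le> d * q" using d0 by simp
  then have "q < r" using q by (rule le_less_trans)
  then have qr: "q < card {..<r}" by simp
  let ?comb = "\<lambda>k. row_comb {..<r} {..<n} (X k)"
  define good where "good = (\<lambda>k c A. A \<subseteq> {..<r} \<and> card {..<r} \<le> card A + q \<and>
     (\<forall>y0. (\<forall>i\<in>A. y0 i \<in> R) \<longrightarrow> (\<exists>y w. ?comb k c y w \<and> (\<forall>i\<in>A. y i = y0 i))) \<and>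
     (c \<noteq> 0 \<longrightarrow> (\<exists>P\<subseteq>{..<n}. card P = Suc q \<and>
        (\<forall>z. \<exists>y w. ?comb k c y w \<and> (\<forall>j\<in>P. res (w j) = z j)))))"
  have "\<forall>k. \<exists>c A. good k c A"
    unfolding good_def using elimination[OF finite_lessThan finite_lessThan qr] by (intro allI)
  then obtain c A where good: "\<And>k. good k (c k) (A k)" by metis
  have A: "A k \<subseteq> {..<r}" "r \<le> card (A k) + q"
    and free: "\<forall>i\<in>A k. y0 i \<in> R \<Longrightarrow> \<exists>y w. ?comb k (c k) y w \<and> (\<forall>i\<in>A k. y i = y0 i)"
    and piv: "c k \<noteq> 0 \<Longrightarrow> \<exists>P\<subseteq>{..<n}. card P = Suc q \<and>
        (\<forall>z. \<exists>y w. ?comb k (c k) y w \<and> (\<forall>j\<in>P. res (w j) = z j))" for k y0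
    using good[of k] by (simp_all add: good_def)
  define C where "C = (\<Prod>k<d. c k)"
  define S where "S = (\<lambda>w. \<Sum>js\<in>?In. (\<Prod>k<d. w k (js ! k)) * emb (T js))"
  have key: "(\<Sum>is\<in>?Ir. (\<Prod>k<d. y k (is ! k)) * W is) = C * S w"
    if yw: "\<And>k. k < d \<Longrightarrow> ?comb k (c k) (y k) (w k)" for y w
  proof -
    have "(\<Sum>is\<in>?Ir. (\<Prod>k<d. y k (is ! k)) * W is) =
        (\<Sum>is\<in>?Ir. \<Sum>js\<in>?In. (\<Prod>k<d. y k (is ! k) * X k (is ! k) (js ! k)) * emb (T js))"
      by (simp add: W_def sum_distrib_left prod.distrib mult.assoc)
    also have "\<dots> = (\<Sum>js\<in>?In. \<Sum>is\<in>?Ir. (\<Prod>k<d. y k (is ! k) * X k (is ! k) (js ! k)) * emb (T js))"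
      by (rule sum.swap)
    also have "\<dots> = (\<Sum>js\<in>?In. (\<Prod>k<d. \<Sum>i<r. y k i * X k i (js ! k)) * emb (T js))"
    proof (rule sum.cong[OF refl])
      fix js
      show "(\<Sum>is\<in>?Ir. (\<Prod>k<d. y k (is ! k) * X k (is ! k) (js ! k)) * emb (T js)) =
          (\<Prod>k<d. \<Sum>i<r. y k i * X k i (js ! k)) * emb (T js)"
        unfolding sum_distrib_right[symmetric]
        using sum_multi_indices_prod[of "\<lambda>k i. y k i * X k i (js ! k)" d r] by simp
    qed
    also have "\<dots> = (\<Sum>js\<in>?In. (\<Prod>k<d. c k * w k (js ! k)) * emb (T js))"
      using yw by (intro sum.cong refl arg_cong2[of _ _ _ _ "(*)"] prod.cong)
        (auto simp: row_comb_def multi_indices_replicate)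
    also have "\<dots> = C * S w"
      by (simp add: S_def C_def prod.distrib sum_distrib_left mult.assoc)
    finally show ?thesis .
  qed
  have lhs: "(\<Sum>is\<in>?Ir. (\<Prod>k<d. y k (is ! k)) * W is) \<in> R"
    "res (\<Sum>is\<in>?Ir. (\<Prod>k<d. y k (is ! k)) * W is) = (\<Sum>j<r. \<Prod>k<d. res (y k j))"
    if yw: "\<And>k. k < d \<Longrightarrow> ?comb k (c k) (y k) (w k)" for y w
  proof -
    have y_in: "y k (is ! k) \<in> R" if "is \<in> ?Ir" "k < d" for k "is"
      using yw[OF that(2)] that by (simp add: row_comb_def multi_indices_replicate)
    then show "(\<Sum>is\<in>?Ir. (\<Prod>k<d. y k (is ! k)) * W is) \<in> R"
      by (intro sum_in mult_in prod_in W(1)) auto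
    have "res (\<Sum>is\<in>?Ir. (\<Prod>k<d. y k (is ! k)) * W is) =
        (\<Sum>is\<in>?Ir. res ((\<Prod>k<d. y k (is ! k)) * W is))"
      using y_in by (intro res_sum mult_in prod_in W(1)) auto
    also have "\<dots> = (\<Sum>is\<in>?Ir. (\<Prod>k<d. res (y k (is ! k))) * unit_tensor d r is)"
    proof (rule sum.cong[OF refl])
      fix "is" assume i: "is \<in> ?Ir"
      have "(\<Prod>k<d. y k (is ! k)) \<in> R" using y_in[OF i] by (intro prod_in) simp
      moreover have "res (\<Prod>k<d. y k (is ! k)) = (\<Prod>k<d. res (y k (is ! k)))"
        using y_in[OF i] by (intro res_prod) simp
      ultimately show "res ((\<Prod>k<d. y k (is ! k)) * W is) =
          (\<Prod>k<d. res (y k (is ! k))) * unit_tensor d r is"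
        using W[OF i] by (simp add: res_mult)
    qed
    also have "\<dots> = (\<Sum>j<r. \<Prod>k<d. res (y k (replicate d j ! k)))" by (rule sum_unit_tensor[OF d0])
    finally show "res (\<Sum>is\<in>?Ir. (\<Prod>k<d. y k (is ! k)) * W is) = (\<Sum>j<r. \<Prod>k<d. res (y k j))"
      by simp
  qed
  have rhs: "S w \<in> R" "res (S w) = (\<Sum>js\<in>?In. (\<Prod>k<d. res (w k (js ! k))) * T js)"
    if yw: "\<And>k. k < d \<Longrightarrow> ?comb k (c k) (y k) (w k)" for y w
  proof -
    have w_in: "w k (js ! k) \<in> R" if "js \<in> ?In" "k < d" for k js
      using yw[OF that(2)] that by (simp add: row_comb_def multi_indices_replicate)
    then show "S w \<in> R" unfolding S_def by (intro sum_in mult_in prod_in emb_in) auto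
    have "res (S w) = (\<Sum>js\<in>?In. res ((\<Prod>k<d. w k (js ! k)) * emb (T js)))"
      unfolding S_def using w_in by (intro res_sum mult_in prod_in emb_in) auto
    also have "\<dots> = (\<Sum>js\<in>?In. (\<Prod>k<d. res (w k (js ! k))) * T js)"
    proof (rule sum.cong[OF refl])
      fix js assume j: "js \<in> ?In"
      have "(\<Prod>k<d. w k (js ! k)) \<in> R" using w_in[OF j] by (intro prod_in) simp
      moreover have "res (\<Prod>k<d. w k (js ! k)) = (\<Prod>k<d. res (w k (js ! k)))"
        using w_in[OF j] by (intro res_prod) simp
      ultimately show "res ((\<Prod>k<d. w k (js ! k)) * emb (T js)) = (\<Prod>k<d. res (w k (js ! k))) * T js"
        by (simp add: res_mult emb_in res_emb)
    qed
    finally show "res (S w) = (\<Sum>js\<in>?In. (\<Prod>k<d. res (w k (js ! k))) * T js)" .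
  qed

  have C: "C \<noteq> 0 \<and> inverse C \<in> R"
  proof (rule ccontr)
    assume "\<not> ?thesis"
    \<comment> \<open>This includes \<open>C = 0\<close>, for which \<open>inverse C = 0\<close>
      lies in \<open>R\<close>.\<close>
    then have C0: "C \<in> R" "res C = 0" using total[of "inverse C"] zero_in res_0 by auto
    define V where "V = (\<lambda>k. {v. \<exists>y w. ?comb k (c k) y w \<and> (\<forall>i<r. v i = res (y i))})"
    have "\<exists>v. (\<forall>k<d. v k \<in> V k) \<and> (\<Sum>j<r. \<Prod>k<d. v k j) \<noteq> 0"
    proof (rule unit_tensor_nonzero_on_product[OF d q, of A])
      show "A k \<subseteq> {..<r}" "r \<le> card (A k) + q" for k by (fact A)+
      show "(\<lambda>i. v i + v' i) \<in> V k" if "v \<in> V k" "v' \<in> V k" for k v v'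
      proof -
        from that obtain y w y' w' where *: "?comb k (c k) y w" "\<forall>i<r. v i = res (y i)"
          "?comb k (c k) y' w'" "\<forall>i<r. v' i = res (y' i)" by (auto simp: V_def)
        have "\<forall>i<r. v i + v' i = res (y i + y' i)"
          using * by (simp add: row_comb_def res_add)
        with row_comb_add[OF *(1,3)] show ?thesis unfolding V_def by blast
      qed
      show "(\<lambda>i. a * v i) \<in> V k" if "v \<in> V k" for k v a
      proof -
        from that obtain y w where *: "?comb k (c k) y w" "\<forall>i<r. v i = res (y i)"
          by (auto simp: V_def)
        have "\<forall>i<r. a * v i = res (emb a * y i)"
          using * by (simp add: row_comb_def res_mult emb_in res_emb)
        with row_comb_scale[OF *(1) emb_in[of a]] show ?thesis unfolding V_def by blast
      qed
      show "\<exists>v\<in>V k. \<forall>i\<in>A k. v i = z i" for k z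
      proof -
        obtain y w where y: "?comb k (c k) y w" "\<forall>i\<in>A k. y i = emb (z i)"
          using free[of k "\<lambda>i. emb (z i)"] emb_in by blast
        then have "(\<lambda>i. res (y i)) \<in> V k" by (auto simp: V_def)
        then show ?thesis using y(2) by (intro bexI[of _ "\<lambda>i. res (y i)"]) (auto simp: res_emb)
      qed
    qed
    then obtain v where v: "\<And>k. k < d \<Longrightarrow> v k \<in> V k" "(\<Sum>j<r. \<Prod>k<d. v k j) \<noteq> 0" by blast
    have "\<forall>k. \<exists>y w. k < d \<longrightarrow> ?comb k (c k) y w \<and> (\<forall>i<r. v k i = res (y i))"
      using v(1) unfolding V_def by blast
    then obtain y w where yw: "\<And>k. k < d \<Longrightarrow> ?comb k (c k) (y k) (w k)"
      and vy: "\<And>k i. k < d \<Longrightarrow> i < r \<Longrightarrow> v k i = res (y k i)" by metis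
    have "(\<Sum>j<r. \<Prod>k<d. v k j) = (\<Sum>j<r. \<Prod>k<d. res (y k j))"
      using vy by (intro sum.cong prod.cong) auto
    also have "\<dots> = res (C * S w)" using lhs(2)[OF yw] key[OF yw] by simp
    also have "\<dots> = 0" using res_mult[OF C0(1) rhs(1)[OF yw]] C0(2) by simp
    finally show False using v(2) by simp
  qed

  define pivots where "pivots = (\<lambda>k P. P \<subseteq> {..<n} \<and> card P = Suc q \<and>
      (\<forall>z. \<exists>y w. ?comb k (c k) y w \<and> (\<forall>j\<in>P. res (w j) = z j)))"
  have "\<exists>P. k < d \<longrightarrow> pivots k P" for k
  proof (cases "k < d")
    case True
    then have "c k \<noteq> 0" using C by (auto simp: C_def)
    from piv[OF this] show ?thesis unfolding pivots_def by blast
  qed simp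
  then obtain P where P': "\<And>k. k < d \<Longrightarrow> pivots k (P k)" by metis
  have P: "P k \<subseteq> {..<n}" "card (P k) = Suc q" if "k < d" for k
    using P'[OF that] by (simp_all add: pivots_def)
  \<comment> \<open>The quotients are chosen to reduce to unit vectors on \<open>P k\<close>; this
    is the normalisation required in \<open>low_rank_block\<close>.\<close>
  define dual where "dual = (\<lambda>k s y w. ?comb k (c k) y w \<and>
      (\<forall>j\<in>P k. res (w j) = (if j = s then 1 else 0)))"
  have "\<exists>y w. k < d \<longrightarrow> dual k s y w" for k s
  proof (cases "k < d")
    case True
    then have "\<forall>z. \<exists>y w. ?comb k (c k) y w \<and> (\<forall>j\<in>P k. res (w j) = z j)"
      using P' by (simp add: pivots_def)
    from spec[OF this, of "\<lambda>j. if j = s then 1 else 0"] show ?thesis unfolding dual_def by blast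
  qed simp
  then obtain y w where dual: "\<And>k s. k < d \<Longrightarrow> dual k s (y k s) (w k s)" by metis
  have yw: "?comb k (c k) (y k s) (w k s)" if "k < d" for k s
    using dual[OF that] by (simp add: dual_def)
  have w: "res (w k s j) = (if j = s then 1 else 0)" if "k < d" "j \<in> P k" for k s j
    using dual[OF that(1)] that(2) by (simp add: dual_def)
  define \<gamma> where "\<gamma> = res (inverse C)"
  \<comment> \<open>The scalar \<open>\<gamma>\<close> is absorbed into factor 0 alone, so that it
    enters each product once.\<close>
  define y' where "y' = (\<lambda>k s j. (if k = 0 then \<gamma> else 1) * res (y k s j))"
  have \<gamma>: "(\<Prod>k<d. if k = 0 then \<gamma> else 1) = \<gamma>" using d0 by simp
  have "(\<Sum>js\<in>?In. (\<Prod>k<d. res (w k (ss ! k) (js ! k))) * T js) = (\<Sum>j<r. \<Prod>k<d. y' k (ss ! k) j)"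
    if "length ss = d" for ss
  proof -
    let ?y = "\<lambda>k. y k (ss ! k)" and ?w = "\<lambda>k. w k (ss ! k)"
    have comb: "\<And>k. k < d \<Longrightarrow> ?comb k (c k) (?y k) (?w k)" using yw by simp
    have "(\<Sum>js\<in>?In. (\<Prod>k<d. res (?w k (js ! k))) * T js) = res (S ?w)" using rhs(2)[OF comb] by simp
    also have "S ?w = inverse C * (\<Sum>is\<in>?Ir. (\<Prod>k<d. ?y k (is ! k)) * W is)"
      using key[OF comb] C by (simp add: field_simps)
    also have "res \<dots> = \<gamma> * (\<Sum>j<r. \<Prod>k<d. res (?y k j))"
      using res_mult[OF conjunct2[OF C] lhs(1)[OF comb]] lhs(2)[OF comb] by (simp add: \<gamma>_def)
    also have "\<dots> = (\<Sum>j<r. \<Prod>k<d. y' k (ss ! k) j)"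
      by (simp add: y'_def prod.distrib \<gamma> sum_distrib_left)
    finally show ?thesis .
  qed
  then have "low_rank_block d n r P T"
    unfolding low_rank_block_def
    using w by (intro exI[of _ "\<lambda>k s j. res (w k s j)"] exI[of _ y']) simp
  then show ?thesis using P by blast
qed

section \<open>The dimension count\<close>

text \<open>The indicator function of the block is a product over the factors, so
  \<open>sum_multi_indices_prod\<close> counts it factor by factor.\<close>

lemma card_multi_indices_block:
  assumes "\<And>k. k < d \<Longrightarrow> P k \<subseteq> {..<n} \<and> card (P k) = m"
  shows "card {js \<in> multi_indices (replicate d n). \<forall>k<d. js ! k \<in> P k} = m ^ d"
proof -
  let ?I = "multi_indices (replicate d n)"
  have ind: "(\<Prod>k<d. if js ! k \<in> P k then 1 else 0) = (if \<forall>k<d. js ! k \<in> P k then 1 else (0 :: nat))"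
    for js
  proof (cases "\<forall>k<d. js ! k \<in> P k")
    case False
    then obtain k where "k < d" "js ! k \<notin> P k" by blast
    then have "(\<Prod>k<d. if js ! k \<in> P k then 1 else (0 :: nat)) = 0"
      by (intro prod_zero) auto
    with False show ?thesis by simp
  qed simp
  have "card {js \<in> ?I. \<forall>k<d. js ! k \<in> P k} = (\<Sum>js\<in>{js \<in> ?I. \<forall>k<d. js ! k \<in> P k}. 1)"
    by simp
  also have "\<dots> = (\<Sum>js\<in>?I. if \<forall>k<d. js ! k \<in> P k then 1 else 0)"
    by (rule sum.inter_filter) (rule finite_multi_indices)
  also have "\<dots> = (\<Sum>js\<in>?I. \<Prod>k<d. if js ! k \<in> P k then 1 else 0)"
    by (simp only: ind)
  also have "\<dots> = (\<Prod>k<d. \<Sum>i<n. if i \<in> P k then 1 else 0)"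
    by (rule sum_multi_indices_prod)
  also have "\<dots> = (\<Prod>k<d. m)"
  proof (rule prod.cong[OF refl])
    fix k assume "k \<in> {..<d}"
    with assms[of k] show "(\<Sum>i<n. if i \<in> P k then 1 else 0) = m"
      by (simp add: sum.If_cases Int_absorb1)
  qed
  finally show ?thesis by simp
qed

text \<open>The relation determines the block of \<open>T\<close> in the positions \<open>P\<close> from the other coordinates of
  \<open>T\<close> and the entries of \<open>a\<close> and \<open>y\<close>, which are fewer than \<open>n\<^sup>d\<close> parameters in total.\<close>

lemma low_rank_block_not_dense:
  assumes P: "\<And>k. k < d \<Longrightarrow> P k \<subseteq> {..<n} \<and> card (P k) = m"
    and less: "d * m * (n + r) < m ^ d"
  shows "\<exists>F\<in>poly_fun (multi_indices (replicate d n)).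
    (\<exists>x\<in>coord_space (multi_indices (replicate d n)). F x \<noteq> (0 :: 'a::alg_closed_field)) \<and>
    (\<forall>T. low_rank_block d n r P T \<longrightarrow> F T = 0)"
proof -
  let ?In = "multi_indices (replicate d n)"
  define B where "B = {js \<in> ?In. \<forall>k<d. js ! k \<in> P k}"
  \<comment> \<open>The summands stand for the entries of \<open>T\<close> outside the block, for
    the rows of the \<open>a k\<close> with index in \<open>P k\<close>, and for the rows of the
    \<open>y k\<close> with index in \<open>P k\<close>.\<close>
  define Par where "Par = (?In - B) <+>
    ((SIGMA k:{..<d}. P k \<times> {..<n}) <+> (SIGMA k:{..<d}. P k \<times> {..<r}))"
  have finP: "finite (P k)" if "k < d" for k
    using P[OF that] by (auto intro: finite_subset)
  have BI: "B \<subseteq> ?In" by (auto simp: B_def)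
  have cB: "card B = m ^ d" unfolding B_def using P by (rule card_multi_indices_block)
  have finB: "finite B" using BI finite_multi_indices by (rule finite_subset)
  have sig: "card (SIGMA k:{..<d}. P k \<times> {..<l}) = d * (m * l)" for l :: nat
    using P finP by (simp add: card_cartesian_product)
  have finsig: "finite (SIGMA k:{..<d}. P k \<times> {..<l})" for l :: nat
    using finP by (intro finite_SigmaI) auto
  have fin: "finite Par" unfolding Par_def using finsig finite_multi_indices by auto
  have "card Par = card ?In - card B + (d * (m * n) + d * (m * r))"
    unfolding Par_def using finsig finite_multi_indices BI finB
    by (simp add: card_Plus sig card_Diff_subset)
  also have "\<dots> < card ?In"
  proof -
    have "d * (m * n) + d * (m * r) < card B" using less by (simp add: cB algebra_simps)
    moreover have "card B \<le> card ?In" using finite_multi_indices BI by (rule card_mono)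
    ultimately show ?thesis by simp
  qed
  finally have card_less: "card Par < card ?In" .
  \<comment> \<open>For \<open>ss\<close> in the block, this is the relation solved for
    \<open>T ss\<close>: among the entries of the block, only \<open>T ss\<close> has a nonzero
    coefficient, namely 1.\<close>
  define g :: "nat list \<Rightarrow> (nat list + (nat \<times> nat \<times> nat) + (nat \<times> nat \<times> nat) \<Rightarrow> 'a) \<Rightarrow> 'a" where
    "g = (\<lambda>ss x. if ss \<in> B
      then (\<Sum>j<r. \<Prod>k<d. x (Inr (Inr (k, ss ! k, j)))) +
        (- 1) * (\<Sum>js\<in>?In - B. (\<Prod>k<d. x (Inr (Inl (k, ss ! k, js ! k)))) * x (Inl js))
      else x (Inl ss))"
  have g_poly: "g ss \<in> poly_fun Par" if "ss \<in> ?In" for ss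
  proof (cases "ss \<in> B")
    case True
    have "(\<lambda>x. (\<Sum>j<r. \<Prod>k<d. x (Inr (Inr (k, ss ! k, j)))) +
        (- 1) * (\<Sum>js\<in>?In - B. (\<Prod>k<d. x (Inr (Inl (k, ss ! k, js ! k)))) * x (Inl js)))
        \<in> poly_fun Par"
      using True
      by (intro poly_fun.add poly_fun.mult poly_fun_sum poly_fun_prod poly_fun.const poly_fun.coord)
        (auto simp: Par_def B_def multi_indices_replicate)
    with True show ?thesis by (simp add: g_def)
  next
    case False
    then have "(\<lambda>x. x (Inl ss)) \<in> poly_fun Par"
      using that by (intro poly_fun.coord) (auto simp: Par_def)
    with False show ?thesis by (simp add: g_def)
  qed
  obtain F where F: "F \<in> poly_fun ?In" "\<exists>x\<in>coord_space ?In. F x \<noteq> 0" "\<And>x. F (\<lambda>j. g j x) = 0"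
    using algebraic_dependence[of Par ?In g, OF fin finite_multi_indices card_less
        infinite_UNIV_alg_closed_field g_poly] by blast
  have "F T = 0" if "low_rank_block d n r P T" for T
  proof -
    from that obtain a y where
      a: "\<forall>k<d. \<forall>s\<in>P k. \<forall>j\<in>P k. a k s j = (if j = s then 1 else 0)"
      and rel: "\<forall>ss. length ss = d \<longrightarrow> (\<forall>k<d. ss ! k \<in> P k) \<longrightarrow>
        (\<Sum>js\<in>?In. (\<Prod>k<d. a k (ss ! k) (js ! k)) * T js) = (\<Sum>j<r. \<Prod>k<d. y k (ss ! k) j)"
      unfolding low_rank_block_def by (elim exE conjE)
    define x where "x = case_sum T (case_sum (\<lambda>(k, s, j). a k s j) (\<lambda>(k, s, j). y k s j))"
    have "g ss x = T ss" if ss: "ss \<in> ?In" for ss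
    proof (cases "ss \<in> B")
      case True
      have len: "length ss = d" and ssP: "\<forall>k<d. ss ! k \<in> P k"
        using True by (auto simp: B_def multi_indices_replicate)
      have "(\<Sum>j<r. \<Prod>k<d. y k (ss ! k) j) = (\<Sum>js\<in>?In. (\<Prod>k<d. a k (ss ! k) (js ! k)) * T js)"
        using rel len ssP by simp
      also have "\<dots> = (\<Sum>js\<in>?In - B. (\<Prod>k<d. a k (ss ! k) (js ! k)) * T js) +
          (\<Sum>js\<in>B. (\<Prod>k<d. a k (ss ! k) (js ! k)) * T js)"
        using finite_multi_indices BI by (rule sum.subset_diff[rotated])
      also have "(\<Sum>js\<in>B. (\<Prod>k<d. a k (ss ! k) (js ! k)) * T js) = (\<Sum>js\<in>B. if js = ss then T js else 0)"
      proof (rule sum.cong[OF refl])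
        fix js assume js: "js \<in> B"
        then have ak: "a k (ss ! k) (js ! k) = (if js ! k = ss ! k then 1 else 0)" if "k < d" for k
          using a ssP that by (auto simp: B_def)
        have "(\<Prod>k<d. a k (ss ! k) (js ! k)) = (if js = ss then 1 else 0)"
        proof (cases "js = ss")
          case True
          then show ?thesis using ak by simp
        next
          case False
          then obtain k where "k < d" "js ! k \<noteq> ss ! k"
            using js len by (auto simp: B_def multi_indices_replicate list_eq_iff_nth_eq)
          then show ?thesis using ak[of k] False by auto
        qed
        then show "(\<Prod>k<d. a k (ss ! k) (js ! k)) * T js = (if js = ss then T js else 0)" by simp
      qed
      also have "\<dots> = T ss" using True finB by simp
      finally show ?thesis using True by (simp add: g_def x_def)
    qed (simp add: g_def x_def)
    then have "F T = F (\<lambda>j. g j x)" by (intro poly_fun_cong[OF F(1)]) simp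
    then show ?thesis using F(3) by simp
  qed
  then show ?thesis using F(1,2) by blast
qed

section \<open>The bound for generic tensors\<close>

lemma ex_prod_poly_fun_nonzero:
  fixes F :: "'p \<Rightarrow> ('i \<Rightarrow> 'a::alg_closed_field) \<Rightarrow> 'a"
  assumes "finite A"
    and "\<And>p. p \<in> A \<Longrightarrow> F p \<in> poly_fun I \<and> (\<exists>x\<in>coord_space I. F p x \<noteq> 0)"
  shows "\<exists>x\<in>coord_space I. (\<Prod>p\<in>A. F p x) \<noteq> 0"
  using assms
proof (induction A rule: finite_induct)
  case empty
  have "(\<lambda>_. 0) \<in> coord_space I" by (simp add: coord_space_def)
  then show ?case by auto
next
  case (insert p A)
  then obtain x where x: "x \<in> coord_space I" "(\<Prod>p\<in>A. F p x) \<noteq> 0" by auto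
  obtain y where y: "F p \<in> poly_fun I" "y \<in> coord_space I" "F p y \<noteq> 0"
    using insert.prems[of p] by auto
  have "(\<lambda>x. \<Prod>p\<in>A. F p x) \<in> poly_fun I" using insert.prems by (intro poly_fun_prod) auto
  with coord_space_irreducible[of "F p" I "\<lambda>x. \<Prod>p\<in>A. F p x" y x] x y
  have "\<exists>z\<in>coord_space I. F p z * (\<Prod>p\<in>A. F p z) \<noteq> 0" by simp
  then show ?case using insert.hyps by simp
qed

lemma zariski_dense_vanish:
  assumes "zariski_dense I S" "F \<in> poly_fun I" "\<And>x. x \<in> S \<Longrightarrow> F x = 0" "x \<in> coord_space I"
  shows "F x = 0"
proof -
  have "F \<in> vanishing_ideal I S" using assms(2,3) by (simp add: vanishing_ideal_def)
  moreover have "x \<in> zero_locus I (vanishing_ideal I S)"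
    using assms(1,4) by (simp add: zariski_dense_def zariski_closure_def)
  ultimately show ?thesis by (simp add: zero_locus_def)
qed

lemma generic_border_subrank_bound:
  assumes d: "d \<ge> 2" and r: "r > 0"
    and gen: "is_generic_border_subrank TYPE('a::alg_closed_field) (replicate d n) r"
  shows "Suc ((r - 1) div d) ^ (d - 1) \<le> 2 * d * n"
proof (rule ccontr)
  let ?In = "multi_indices (replicate d n)"
  \<comment> \<open>The largest \<open>q\<close> with \<open>d * q < r\<close>.\<close>
  define q where "q = (r - 1) div d"
  assume "\<not> ?thesis"
  then have big: "2 * d * n < Suc q ^ (d - 1)" by (simp add: q_def)
  have q: "d * q < r"
    using r by (metis Suc_pred' le_imp_less_Suc q_def times_div_less_eq_dividend)
  define S where "S = {T :: nat list \<Rightarrow> 'a. T \<in> tensors (replicate d n) \<and> border_subrank (replicate d n) T = r}"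
  have dense: "zariski_dense ?In S"
    using gen by (simp add: is_generic_border_subrank_def S_def)
  have zero: "(\<lambda>_. 0) \<in> (coord_space ?In :: (nat list \<Rightarrow> 'a) set)" by (simp add: coord_space_def)
  \<comment> \<open>A dense set has a member, as otherwise the constant 1 would vanish on it. Any
    member yields \<open>r \<le> n\<close>, which allows \<open>n + r\<close> to be replaced by
    \<open>2 * n\<close>.\<close>
  have "S \<noteq> {}"
    using zariski_dense_vanish[OF dense poly_fun.const[of 1] _ zero] by auto
  then obtain T0 :: "nat list \<Rightarrow> 'a" where "border_subrank (replicate d n) T0 = r" by (auto simp: S_def)
  with border_subrank_le(2)[of "replicate d n" T0] d have rn: "r \<le> n" by simp
  have "d * Suc q * (n + r) \<le> d * Suc q * (n + n)" using rn by (intro mult_left_mono) simp_all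
  also have "\<dots> = Suc q * (2 * d * n)" by (simp add: algebra_simps)
  also have "\<dots> < Suc q * Suc q ^ (d - 1)" using big by (intro mult_strict_left_mono) auto
  also have "\<dots> = Suc q ^ d" using d by (simp flip: power_Suc)
  finally have less: "d * Suc q * (n + r) < Suc q ^ d" .
  \<comment> \<open>The positions \<open>P\<close> depend on the tensor, but there are only finitely
    many choices once \<open>P\<close> is made extensional. The product of the polynomials for all
    choices vanishes on \<open>S\<close>, and by irreducibility it is not zero everywhere.\<close>
  define Pats where "Pats = PiE {..<d} (\<lambda>_. {A. A \<subseteq> {..<n} \<and> card A = Suc q})"
  define good where "good = (\<lambda>P (F :: (nat list \<Rightarrow> 'a) \<Rightarrow> 'a). F \<in> poly_fun ?In \<and>
      (\<exists>x\<in>coord_space ?In. F x \<noteq> 0) \<and> (\<forall>T. low_rank_block d n r P T \<longrightarrow> F T = 0))"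
  have "\<exists>F. P \<in> Pats \<longrightarrow> good P F" for P
  proof (cases "P \<in> Pats")
    case True
    then have "P k \<subseteq> {..<n} \<and> card (P k) = Suc q" if "k < d" for k
      using that by (auto simp: Pats_def PiE_iff)
    from low_rank_block_not_dense[of d P, OF this less, where 'a = 'a] show ?thesis
      unfolding good_def by blast
  qed simp
  then obtain F where good: "\<And>P. P \<in> Pats \<Longrightarrow> good P (F P)" by metis
  have F: "F P \<in> poly_fun ?In \<and> (\<exists>x\<in>coord_space ?In. F P x \<noteq> 0)" if "P \<in> Pats" for P
    using good[OF that] by (simp add: good_def)
  have F0: "F P T = 0" if "P \<in> Pats" "low_rank_block d n r P T" for P T
    using good[OF that(1)] that(2) by (simp add: good_def)
  have fin: "finite Pats" unfolding Pats_def by (intro finite_PiE) auto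
  have "(\<Prod>P\<in>Pats. F P T) = 0" if "T \<in> S" for T
  proof -
    have "unit_tensor d r \<in>
        zariski_closure (multi_indices (replicate d r)) (tensor_images (replicate d n) r T)"
      using border_subrank_le(1)[of "replicate d n" T] d that by (simp add: S_def)
    from low_rank_block_of_closure[OF d q this] obtain P where
      P: "\<forall>k<d. P k \<subseteq> {..<n} \<and> card (P k) = Suc q" and low: "low_rank_block d n r P T"
      by (elim exE conjE)
    let ?P = "restrict P {..<d}"
    have "?P \<in> Pats" using P by (simp add: Pats_def)
    moreover have "low_rank_block d n r ?P T"
      using low unfolding low_rank_block_def by simp
    ultimately have "F ?P T = 0" by (rule F0)
    with fin \<open>?P \<in> Pats\<close> show ?thesis by (intro prod_zero) auto
  qed
  moreover have "(\<lambda>T. \<Prod>P\<in>Pats. F P T) \<in> poly_fun ?In" using F by (intro poly_fun_prod) auto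
  ultimately have "\<forall>x\<in>coord_space ?In. (\<Prod>P\<in>Pats. F P x) = 0"
    using zariski_dense_vanish[OF dense, of "\<lambda>T. \<Prod>P\<in>Pats. F P T"] by blast
  moreover have "\<exists>x\<in>coord_space ?In. (\<Prod>P\<in>Pats. F P x) \<noteq> 0"
    using fin F by (rule ex_prod_poly_fun_nonzero)
  ultimately show False by blast
qed

theorem theorem1p2:
  fixes d :: nat and s :: "nat \<Rightarrow> nat"
  assumes "d \<ge> 2"
    and "\<And>n. is_generic_border_subrank TYPE('a::alg_closed_field) (replicate d n) (s n)"
  shows "(\<lambda>n. real (s n)) \<in> O(\<lambda>n. real n powr (1 / real (d - 1)))"
proof -
  define e where "e = 1 / real (d - 1)"
  have e: "e > 0" using assms(1) by (simp add: e_def)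
  have "real (s n) \<le> real d * real (2 * d) powr e * real n powr e" for n
  proof (cases "s n = 0")
    case False
    define m where "m = Suc ((s n - 1) div d)"
    \<comment> \<open>Division with remainder gives \<open>s n - 1 < d * m\<close>, so replacing
      \<open>s n\<close> by the side length \<open>m\<close> of the block costs only the constant
      factor \<open>d\<close>.\<close>
    have "s n - 1 < d + d * ((s n - 1) div d)"
      using assms(1) by (intro dividend_less_times_div) simp
    then have "s n \<le> d * m" by (simp add: m_def)
    then have sm: "real (s n) \<le> real d * real m" unfolding of_nat_mult[symmetric] of_nat_le_iff .
    have "m ^ (d - 1) \<le> 2 * d * n"
      unfolding m_def using generic_border_subrank_bound[OF assms(1) _ assms(2)] False by simp
    then have "real (m ^ (d - 1)) \<le> real (2 * d * n)" unfolding of_nat_le_iff .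
    then have "real m ^ (d - 1) \<le> real (2 * d) * real n" by simp
    then have "(real m ^ (d - 1)) powr e \<le> (real (2 * d) * real n) powr e"
      using e by (intro powr_mono2) auto
    also have "real m ^ (d - 1) = real m powr real (d - 1)"
      by (rule powr_realpow[symmetric]) (simp add: m_def)
    also have "(real m powr real (d - 1)) powr e = real m"
      using assms(1) by (simp add: powr_powr e_def m_def del: of_nat_Suc)
    also have "(real (2 * d) * real n) powr e = real (2 * d) powr e * real n powr e"
      by (rule powr_mult)
    finally have "real d * real m \<le> real d * (real (2 * d) powr e * real n powr e)"
      by (rule mult_left_mono) simp
    with sm show ?thesis by (simp only: mult.assoc)
  qed simp
  then have bound: "norm (real (s n)) \<le> real d * real (2 * d) powr e * norm (real n powr e)" for n
    by simp
  have "(\<lambda>n. real (s n)) \<in> O(\<lambda>n. real n powr e)"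
    by (rule bigoI[OF always_eventually], rule allI, rule bound)
  then show ?thesis by (simp only: e_def)
qed

end
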